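(* Let $T \in \mathbb{F}^n \otimes \mathbb{F}^n \otimes \mathbb{F}^n$ be concise. Then $\lim_{m\to\infty} Q(T^{\boxtimes m})^{1/m} \geq n^{1/3}$.
   Context: $\mathbb{F}$ is any field. $T$ is concise if each of its three flattenings (grouping two tensor legs) has rank $n$. The subrank $Q(T)$ is the largest $r$ such that there are linear maps $L_i$ with $(L_1\otimes L_2\otimes L_3)T=\sum_{i=1}^r e_i\otimes e_i\otimes e_i$; $\boxtimes$ is the Kronecker product, and $\lim_{m\to\infty} Q(T^{\boxtimes m})^{1/m}$ is the asymptotic subrank. *)

theory Defs
  imports Complex_Main "Jordan_Normal_Form.DL_Rank"
begin

text \<open>
  An element of \<open>F\<^sup>n \<otimes> F\<^sup>n \<otimes> F\<^sup>n\<close> is given by its coordinates \<open>T i j k\<close> with \<open>i, j, k < n\<close>.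
  The dimension \<open>n\<close> is passed separately; values of \<open>T\<close> at indices \<open>\<ge> n\<close> are irrelevant
  in all notions below.
\<close>

type_synonym 'a tensor3 = "nat \<Rightarrow> nat \<Rightarrow> nat \<Rightarrow> 'a"

text \<open>
  The flattenings as \<open>n \<times> n\<^sup>2\<close> matrices; the pair of grouped indices \<open>(j, k)\<close> is encoded by the
  column index \<open>j * n + k\<close>.
\<close>

definition flattening1 :: "nat \<Rightarrow> 'a tensor3 \<Rightarrow> 'a mat" where
  "flattening1 n T = mat n (n * n) (\<lambda>(i, c). T i (c div n) (c mod n))"

definition flattening2 :: "nat \<Rightarrow> 'a tensor3 \<Rightarrow> 'a mat" where
  "flattening2 n T = mat n (n * n) (\<lambda>(j, c). T (c div n) j (c mod n))"

definition flattening3 :: "nat \<Rightarrow> 'a tensor3 \<Rightarrow> 'a mat" where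
  "flattening3 n T = mat n (n * n) (\<lambda>(k, c). T (c div n) (c mod n) k)"

definition concise :: "nat \<Rightarrow> 'a::field tensor3 \<Rightarrow> bool" where
  "concise n T \<longleftrightarrow>
     vec_space.rank n (flattening1 n T) = n \<and>
     vec_space.rank n (flattening2 n T) = n \<and>
     vec_space.rank n (flattening3 n T) = n"

text \<open>The coordinates of \<open>(A \<otimes> B \<otimes> C) T\<close>, for linear maps given by their matrices.\<close>

definition tensor_apply :: "'a::field mat \<Rightarrow> 'a mat \<Rightarrow> 'a mat \<Rightarrow> 'a tensor3 \<Rightarrow> 'a tensor3" where
  "tensor_apply A B C T = (\<lambda>p q s.
     \<Sum>i<dim_col A. \<Sum>j<dim_col B. \<Sum>k<dim_col C. A $$ (p, i) * B $$ (q, j) * C $$ (s, k) * T i j k)"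

definition simple_tensor :: "'a::field vec \<Rightarrow> 'a vec \<Rightarrow> 'a vec \<Rightarrow> 'a tensor3" where
  "simple_tensor u v w = (\<lambda>p q s. u $ p * v $ q * w $ s)"

definition unit_tensor :: "nat \<Rightarrow> 'a::field tensor3" where
  "unit_tensor r = (\<lambda>p q s. \<Sum>i<r. simple_tensor (unit_vec r i) (unit_vec r i) (unit_vec r i) p q s)"

definition restricts_to_unit :: "nat \<Rightarrow> 'a::field tensor3 \<Rightarrow> nat \<Rightarrow> bool" where
  "restricts_to_unit n T r \<longleftrightarrow>
     (\<exists>A\<in>carrier_mat r n. \<exists>B\<in>carrier_mat r n. \<exists>C\<in>carrier_mat r n.
        \<forall>p<r. \<forall>q<r. \<forall>s<r. tensor_apply A B C T p q s = unit_tensor r p q s)"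

definition subrank :: "nat \<Rightarrow> 'a::field tensor3 \<Rightarrow> nat" where
  "subrank n T = Max {r. restricts_to_unit n T r}"

text \<open>
  Kronecker product of \<open>S\<close> with a tensor \<open>T\<close> of format \<open>n \<times> n \<times> n\<close>: the pair of indices
  \<open>(i', i)\<close> is encoded by \<open>i' * n + i\<close>.
\<close>

definition kronecker :: "nat \<Rightarrow> 'a::field tensor3 \<Rightarrow> 'a tensor3 \<Rightarrow> 'a tensor3" where
  "kronecker n S T = (\<lambda>i j k. S (i div n) (j div n) (k div n) * T (i mod n) (j mod n) (k mod n))"

text \<open>For \<open>T\<close> of format \<open>n \<times> n \<times> n\<close>, the \<open>m\<close>-th power has format \<open>n\<^sup>m \<times> n\<^sup>m \<times> n\<^sup>m\<close>.\<close>

primrec kronecker_power :: "nat \<Rightarrow> 'a::field tensor3 \<Rightarrow> nat \<Rightarrow> 'a tensor3" where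
  "kronecker_power n T 0 = (\<lambda>i j k. 1)"
| "kronecker_power n T (Suc m) = kronecker n (kronecker_power n T m) T"

text \<open>The set in the definition of the subrank is finite and nonempty, so its \<open>Max\<close> is meaningful.\<close>

lemma unit_tensor_eq:
  assumes "p < r" "q < r" "s < r"
  shows "(unit_tensor r p q s :: 'a::field) = (if p = q \<and> q = s then 1 else 0)"
proof -
  have "(unit_tensor r p q s :: 'a) = (\<Sum>i<r. if i = p then (if p = q \<and> q = s then 1 else 0) else 0)"
    unfolding unit_tensor_def simple_tensor_def
    using assms by (intro sum.cong) auto
  then show ?thesis using assms by simp
qed

lemma restricts_to_unit_0: "restricts_to_unit n T 0"
  unfolding restricts_to_unit_def
  by (rule bexI[of _ "0\<^sub>m 0 n"], rule bexI[of _ "0\<^sub>m 0 n"], rule bexI[of _ "0\<^sub>m 0 n"]) simp_all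

lemma restricts_to_unit_le:
  fixes T :: "'a::field tensor3"
  assumes "restricts_to_unit n T r"
  shows "r \<le> n"
proof (rule ccontr)
  assume "\<not> r \<le> n"
  then have nr: "n < r" by simp
  from assms obtain A B C where
    car: "A \<in> carrier_mat r n" "B \<in> carrier_mat r n" "C \<in> carrier_mat r n" and
    eq: "\<And>p q s. p < r \<Longrightarrow> q < r \<Longrightarrow> s < r \<Longrightarrow> tensor_apply A B C T p q s = unit_tensor r p q s"
    unfolding restricts_to_unit_def by blast
  define d where "d i q = (\<Sum>j<n. \<Sum>k<n. B $$ (q, j) * C $$ (q, k) * T i j k)" for i q
  define A' where "A' = mat r r (\<lambda>(p, i). if i < n then A $$ (p, i) else 0)"
  define D' where "D' = mat r r (\<lambda>(i, q). if i < n then d i q else 0)"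
  have "A' * D' = 1\<^sub>m r"
  proof (rule eq_matI)
    fix p q assume "p < dim_row (1\<^sub>m r :: 'a mat)" "q < dim_col (1\<^sub>m r :: 'a mat)"
    then have pq: "p < r" "q < r" by auto
    have "(A' * D') $$ (p, q) = (\<Sum>i<r. if i < n then A $$ (p, i) * d i q else 0)"
      using pq unfolding A'_def D'_def
      by (simp add: scalar_prod_def atLeast0LessThan) (rule sum.cong, simp_all)
    also have "\<dots> = (\<Sum>i<n. A $$ (p, i) * d i q)"
      using nr by (intro sum.mono_neutral_cong_right) auto
    also have "\<dots> = tensor_apply A B C T p q q"
      using car by (simp add: d_def tensor_apply_def sum_distrib_left mult.assoc)
    also have "\<dots> = 1\<^sub>m r $$ (p, q)"
      using eq[OF pq(1) pq(2) pq(2)] pq by (simp add: unit_tensor_eq)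
    finally show "(A' * D') $$ (p, q) = 1\<^sub>m r $$ (p, q)" .
  qed (auto simp: A'_def D'_def)
  then have "D' * A' = 1\<^sub>m r"
    by (rule mat_mult_left_right_inverse[rotated 2]) (simp_all add: A'_def D'_def)
  moreover have "(D' * A') $$ (n, n) = 0"
    using nr by (auto simp: A'_def D'_def scalar_prod_def)
  ultimately show False using nr by simp
qed

lemma finite_restricts_to_unit: "finite {r. restricts_to_unit n T r}"
  by (rule finite_subset[of _ "{..n}"]) (auto dest: restricts_to_unit_le)

end

theory Submission
  imports Defs "HOL-Library.Function_Algebras" "HOL-Library.FuncSet" "HOL-Real_Asymp.Real_Asymp"
begin

text \<open>
  Let \<open>a\<close>, \<open>b\<close>, \<open>c\<close> be the largest ranks of the matrices obtained from a nondegenerate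
  \<open>N \<times> N \<times> N\<close> tensor by contracting its first, second and third leg with a vector. Any two of
  them have product at least \<open>N/2\<close>, over every field. Taking the Kronecker product of one
  contraction of each kind, the third power of the tensor restricts to the matrix multiplication
  tensor of format \<open>a \<times> b \<times> c\<close>, whose asymptotic subrank is, by Strassen's pigeonhole
  construction of edge-disjoint triangles, at least \<open>min (ab) (bc) (ca) / 4\<close>. For \<open>N = n\<^sup>m\<close> this gives
  the lower bound \<open>(n\<^sup>m / 8)\<close> raised to \<open>1 / (3m)\<close> for the asymptotic subrank, and \<open>m\<close> tends to
  infinity. Constant factors are harmless here, which is why no field extension is needed.
\<close>

section \<open>Families of bilinear forms of bounded rank\<close>

text \<open>A single contraction of rank \<open>a\<close> yields only an identity matrix on two
  legs, whose subrank as a tensor is at most one. One contraction per leg is what couples all three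
  legs, and the three copies of the tensor spent on this are the source of the exponent 1/3. The
  ranks \<open>a\<close>, \<open>b\<close>, \<open>c\<close> may be very unbalanced, so only their
  pairwise products can be controlled; these are also what the number of triangles depends on.

  Over a small field no generic contraction need exist. Ranks are therefore maximised over the
  contractions that do exist, and the price is the factor 2 in the product bound. Together with the
  factor 4 from the triangles this is the constant 8, paid once per group of \<open>3 * m\<close>
  copies. Since the logarithm of the subrank is superadditive, the limit exists as a supremum, and
  an estimate along multiples of \<open>3 * m\<close> suffices.\<close>

lemma underdetermined_system:
  fixes a :: "'e \<Rightarrow> nat \<Rightarrow> 'a::field"
  assumes "finite E" "card E < n"
  shows "\<exists>c. (\<exists>j<n. c j \<noteq> 0) \<and> (\<forall>e\<in>E. (\<Sum>j<n. a e j * c j) = 0)"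
proof -
  obtain h where h: "bij_betw h {0..<card E} E"
    using ex_bij_betw_nat_finite[OF assms(1)] by blast
  define g where "g i = vec n (\<lambda>j. if i < card E then a (h i) j else 0)" for i
  \<comment> \<open>Row \<open>card E\<close> is zero by construction and exists because
    \<open>card E < n\<close>, so the square matrix is singular.\<close>
  define M where "M = mat\<^sub>r n n (\<lambda>i. if i = card E then 0\<^sub>v n else g i)"
  have M: "M \<in> carrier_mat n n" by (simp add: M_def)
  have "det M = 0"
    unfolding M_def by (rule det_row_0[OF assms(2)]) (simp add: g_def)
  then obtain v where v: "v \<in> carrier_vec n" "v \<noteq> 0\<^sub>v n" "M *\<^sub>v v = 0\<^sub>v n"
    using det_0_iff_vec_prod_zero_field[OF M] by blast
  have "\<exists>j<n. v $ j \<noteq> 0"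
  proof (rule ccontr)
    assume "\<not> ?thesis"
    then have "v = 0\<^sub>v n" using v(1) by (intro eq_vecI) auto
    with v(2) show False by simp
  qed
  moreover have "(\<Sum>j<n. a e j * v $ j) = 0" if "e \<in> E" for e
  proof -
    have "e \<in> h ` {0..<card E}" using that h by (simp add: bij_betw_def)
    then obtain i where i: "i < card E" "e = h i" by auto
    then have "i < n" using assms(2) by simp
    then have "(M *\<^sub>v v) $ i = (\<Sum>j<n. a e j * v $ j)"
      using i v(1) by (auto simp: M_def g_def scalar_prod_def atLeast0LessThan intro!: sum.cong)
    then show ?thesis using v(3) \<open>i < n\<close> by simp
  qed
  ultimately show ?thesis by (intro exI[of _ "\<lambda>j. v $ j"]) blast
qed

lemma bounded_has_greatest:
  fixes P :: "nat \<Rightarrow> bool"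
  assumes "P s" "\<forall>t. P t \<longrightarrow> t \<le> r"
  shows "\<exists>t. P t \<and> (\<forall>t'. P t' \<longrightarrow> t' \<le> t)"
proof (intro exI conjI allI impI)
  show "P (GREATEST t. P t)" by (rule GreatestI_nat[of P s r]) (use assms in auto)
  show "t' \<le> (GREATEST t. P t)" if "P t'" for t'
    by (rule Greatest_le_nat[of P t' r]) (use assms that in auto)
qed

text \<open>Scalings are parameters because the vectors in use are functions scaled pointwise. The
  intended \<open>F\<close> consists of all slices \<open>trilin n T u\<close> of one tensor;
  \<open>closed_add\<close> supplies the form \<open>A + B\<close> in the bound on kernels.\<close>

locale bilinear_family =
  left: vector_space s1 + right: vector_space s2
  for s1 :: "'a::field \<Rightarrow> 'b::ab_group_add \<Rightarrow> 'b"
    and s2 :: "'a \<Rightarrow> 'c::ab_group_add \<Rightarrow> 'c" +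
  fixes F :: "('b \<Rightarrow> 'c \<Rightarrow> 'a) set"
  assumes add_left: "B \<in> F \<Longrightarrow> B (x + x') y = B x y + B x' y"
    and scale_left: "B \<in> F \<Longrightarrow> B (s1 c x) y = c * B x y"
    and add_right: "B \<in> F \<Longrightarrow> B x (y + y') = B x y + B x y'"
    and scale_right: "B \<in> F \<Longrightarrow> B x (s2 c y) = c * B x y"
    and closed_add: "A \<in> F \<Longrightarrow> B \<in> F \<Longrightarrow> (\<lambda>x y. A x y + B x y) \<in> F"
begin

lemma zero_left: "B \<in> F \<Longrightarrow> B 0 y = 0"
  using add_left[of B 0 0 y] by (simp only: add_0_left add_cancel_right_left simp_thms)

lemma zero_right: "B \<in> F \<Longrightarrow> B x 0 = 0"
  using add_right[of B x 0 0] by (simp only: add_0_left add_cancel_right_left simp_thms)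

lemma diff_left: "B \<in> F \<Longrightarrow> B (x - x') y = B x y - B x' y"
  using add_left[of B "x - x'" x' y] by simp

lemma diff_right: "B \<in> F \<Longrightarrow> B x (y - y') = B x y - B x y'"
  using add_right[of B x "y - y'" y'] by simp

lemma sum_left: "B \<in> F \<Longrightarrow> B (\<Sum>i\<in>I. s1 (c i) (f i)) y = (\<Sum>i\<in>I. c i * B (f i) y)"
  by (induction I rule: infinite_finite_induct) (simp_all add: zero_left add_left scale_left)

lemma sum_right: "B \<in> F \<Longrightarrow> B x (\<Sum>i\<in>I. s2 (c i) (f i)) = (\<Sum>i\<in>I. c i * B x (f i))"
  by (induction I rule: infinite_finite_induct) (simp_all add: zero_right add_right scale_right)

text \<open>
  \<open>B\<close> has rank at least \<open>r\<close> on \<open>V \<times> W\<close> iff it admits dual families of size \<open>r\<close> there; ranks of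
  bilinear forms are only used in this guise.
\<close>

definition dual_families :: "('b \<Rightarrow> 'c \<Rightarrow> 'a) \<Rightarrow> 'b set \<Rightarrow> 'c set \<Rightarrow> nat \<Rightarrow> (nat \<Rightarrow> 'b) \<Rightarrow> (nat \<Rightarrow> 'c) \<Rightarrow> bool" where
  "dual_families B V W r v w \<longleftrightarrow>
     (\<forall>p<r. v p \<in> V \<and> w p \<in> W) \<and> (\<forall>p<r. \<forall>q<r. B (v p) (w q) = (if p = q then 1 else 0))"

lemma dual_families_mono:
  "dual_families B V W r v w \<Longrightarrow> V \<subseteq> V' \<Longrightarrow> W \<subseteq> W' \<Longrightarrow> dual_families B V' W' r v w"
  unfolding dual_families_def by blast

text \<open>A dual family that cannot be enlarged detects the left radical: an \<open>x\<close>
  orthogonal to all \<open>w' q\<close> but not to some \<open>y\<close> would supply one more dual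
  pair. The given \<open>w\<close> survive, so orthogonality already known against them carries
  over.\<close>

lemma extend_dual_families:
  assumes B: "B \<in> F" and V: "left.subspace V" and W: "right.subspace W"
    and d: "dual_families B V W s v w"
    and bound: "\<forall>t v w. dual_families B V W t v w \<longrightarrow> t \<le> r"
  shows "\<exists>t v' w'. s \<le> t \<and> t \<le> r \<and> dual_families B V W t v' w' \<and> (\<forall>p<s. w' p = w p) \<and>
    (\<forall>x\<in>V. (\<forall>q<t. B x (w' q) = 0) \<longrightarrow> (\<forall>y\<in>W. B x y = 0))"
proof -
  define P where "P t \<longleftrightarrow> s \<le> t \<and> (\<exists>v' w'. dual_families B V W t v' w' \<and> (\<forall>p<s. w' p = w p))" for t
  have "P s" using d by (auto simp: P_def)
  moreover have "\<forall>t. P t \<longrightarrow> t \<le> r" using bound by (auto simp: P_def)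
  ultimately obtain t where t: "P t" and t_max: "\<forall>t'. P t' \<longrightarrow> t' \<le> t"
    using bounded_has_greatest[of P] by blast
  then obtain v' w' where st: "s \<le> t" and d': "dual_families B V W t v' w'"
    and ext: "\<forall>p<s. w' p = w p"
    unfolding P_def by blast
  have d'V: "v' p \<in> V" and d'W: "w' p \<in> W" if "p < t" for p
    using d' that by (auto simp: dual_families_def)
  have d'B: "B (v' p) (w' q) = (if p = q then 1 else 0)" if "p < t" "q < t" for p q
    using d' that by (auto simp: dual_families_def)
  have "B x y = 0" if x: "x \<in> V" and y: "y \<in> W" and 0: "\<And>q. q < t \<Longrightarrow> B x (w' q) = 0" for x y
  proof (rule ccontr)
    assume nz: "B x y \<noteq> 0"
    \<comment> \<open>Subtracting the dual expansion makes \<open>z\<close> orthogonal to every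
      \<open>v' q\<close> without changing its pairing with \<open>x\<close>; scaling
      \<open>x\<close> then normalises that pairing.\<close>
    define z where "z = y - (\<Sum>q<t. s2 (B (v' q) y) (w' q))"
    define v'' where "v'' = v'(t := s1 (inverse (B x y)) x)"
    define w'' where "w'' = w'(t := z)"
    have z: "z \<in> W" unfolding z_def
      using y d'W by (intro right.subspace_diff[OF W] right.subspace_sum[OF W] right.subspace_scale[OF W]) auto
    have xz: "B x z = B x y"
      unfolding z_def by (simp add: diff_right[OF B] sum_right[OF B] 0)
    have vz: "B (v' p) z = 0" if "p < t" for p
    proof -
      have "(\<Sum>q<t. B (v' q) y * B (v' p) (w' q)) = (\<Sum>q<t. if q = p then B (v' p) y else 0)"
        using that by (intro sum.cong) (auto simp: d'B)
      then show ?thesis unfolding z_def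
        using that by (simp add: diff_right[OF B] sum_right[OF B])
    qed
    have "dual_families B V W (Suc t) v'' w''"
      unfolding dual_families_def
    proof (intro conjI allI impI)
      fix p assume "p < Suc t"
      then show "v'' p \<in> V" "w'' p \<in> W"
        using d'V d'W z left.subspace_scale[OF V x] by (auto simp: v''_def w''_def less_Suc_eq)
    next
      fix p q assume "p < Suc t" "q < Suc t"
      then consider "p < t" "q < t" | "p = t" "q < t" | "p < t" "q = t" | "p = t" "q = t"
        by linarith
      then show "B (v'' p) (w'' q) = (if p = q then 1 else 0)"
        by cases (simp_all add: v''_def w''_def d'B scale_left[OF B] 0 vz xz nz)
    qed
    moreover have "\<forall>p<s. w'' p = w p" using ext st by (auto simp: w''_def)
    ultimately have "P (Suc t)" unfolding P_def using st by (intro conjI exI) auto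
    then have "Suc t \<le> t" using t_max by blast
    then show False by simp
  qed
  moreover have "t \<le> r" using bound d' by blast
  ultimately show ?thesis using st d' ext by (intro exI[of _ t] exI[of _ v'] exI[of _ w']) simp
qed

text \<open>
  The rank drops by half on the kernels of a form \<open>A\<close> of maximal rank: once the \<open>v p\<close> are made
  \<open>B\<close>-orthogonal to the \<open>w' t\<close>, the forms \<open>B\<close> and \<open>A + B\<close> of rank at most \<open>r\<close> impose at most
  \<open>2 (r - s)\<close> conditions on combinations of the \<open>r\<close> vectors \<open>v p\<close>, and a common solution lies in
  the radical of their difference \<open>A\<close>. This replaces the usual genericity argument, which needs a
  large field.
\<close>

lemma rank_on_kernels:
  assumes A: "A \<in> F" and B: "B \<in> F" and V: "left.subspace V" and W: "right.subspace W"
    and bound: "\<forall>C\<in>F. \<forall>t v w. dual_families C V W t v w \<longrightarrow> t \<le> r"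
    and dA: "dual_families A V W r v w"
    and dB: "dual_families B {x \<in> V. \<forall>q<r. A x (w q) = 0} {y \<in> W. \<forall>p<r. A (v p) y = 0} s v' w'"
  shows "2 * s \<le> r"
proof (rule ccontr)
  assume "\<not> 2 * s \<le> r"
  then have sr: "r < 2 * s" by simp
  have b0: "\<forall>t v w. dual_families A V W t v w \<longrightarrow> t \<le> r" using bound A by blast
  have b1: "\<forall>t v w. dual_families B V W t v w \<longrightarrow> t \<le> r" using bound B by blast
  define C where "C = (\<lambda>x y. A x y + B x y)"
  have C: "C \<in> F" unfolding C_def by (rule closed_add[OF A B])
  have b2: "\<forall>t v w. dual_families C V W t v w \<longrightarrow> t \<le> r" using bound C by blast
  have vp: "v p \<in> V" "w p \<in> W" if "p < r" for p
    using dA that by (auto simp: dual_families_def)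
  have v': "v' t \<in> V" "w' t \<in> W" if "t < s" for t
    using dB that by (auto simp: dual_families_def)
  have Av': "A (v' t) (w q) = 0" if "t < s" "q < r" for t q
    using dB that by (auto simp: dual_families_def)
  have Aw': "A (v p) (w' t) = 0" if "t < s" "p < r" for t p
    using dB that by (auto simp: dual_families_def)
  \<comment> \<open>Here \<open>t0 = r\<close>, so vanishing on the \<open>w q\<close> alone puts a
    vector into the left radical of \<open>A\<close>.\<close>
  obtain t0 v0 w0 where t0: "r \<le> t0" "t0 \<le> r" "\<forall>p<r. w0 p = w p"
    and rad: "\<forall>x\<in>V. (\<forall>q<t0. A x (w0 q) = 0) \<longrightarrow> (\<forall>y\<in>W. A x y = 0)"
    using extend_dual_families[OF A V W dA b0] by blast
  have A0: "A (v' t) y = 0" if "t < s" "y \<in> W" for t y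
  proof -
    have "\<forall>q<t0. A (v' t) (w0 q) = 0" using t0 Av'[OF that(1)] by auto
    then show ?thesis using rad v'(1)[OF that(1)] that(2) by blast
  qed
  have dB': "dual_families B V W s v' w'"
    using dB by (rule dual_families_mono) auto
  have dC: "dual_families C V W s v' w'"
    using dB' A0 v'(2) unfolding dual_families_def C_def by simp
  obtain t1 v1 w1 where t1: "s \<le> t1" "t1 \<le> r" "\<forall>p<s. w1 p = w' p"
    and rad1: "\<forall>x\<in>V. (\<forall>q<t1. B x (w1 q) = 0) \<longrightarrow> (\<forall>y\<in>W. B x y = 0)"
    using extend_dual_families[OF B V W dB' b1] by blast
  obtain t2 v2 w2 where t2: "s \<le> t2" "t2 \<le> r" "\<forall>p<s. w2 p = w' p"
    and rad2: "\<forall>x\<in>V. (\<forall>q<t2. C x (w2 q) = 0) \<longrightarrow> (\<forall>y\<in>W. C x y = 0)"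
    using extend_dual_families[OF C V W dC b2] by blast
  \<comment> \<open>The \<open>v' t\<close> lie in the left radical of \<open>A\<close>, so this
    correction leaves pairings under \<open>A\<close> with vectors of \<open>W\<close>
    unchanged.\<close>
  define u where "u p = v p - (\<Sum>t<s. s1 (B (v p) (w' t)) (v' t))" for p
  have uV: "u p \<in> V" if "p < r" for p
    unfolding u_def using vp v' that
    by (intro left.subspace_diff[OF V] left.subspace_sum[OF V] left.subspace_scale[OF V]) auto
  have Bu: "B (u p) (w' t) = 0" if "p < r" "t < s" for p t
  proof -
    have "(\<Sum>t'<s. B (v p) (w' t') * B (v' t') (w' t)) = (\<Sum>t'<s. if t' = t then B (v p) (w' t) else 0)"
      using dB that by (intro sum.cong) (auto simp: dual_families_def)
    then show ?thesis unfolding u_def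
      using that by (simp add: diff_left[OF B] sum_left[OF B])
  qed
  have Au: "A (u p) y = A (v p) y" if "p < r" "y \<in> W" for p y
    unfolding u_def using that by (simp add: diff_left[OF A] sum_left[OF A] A0)
  have Cu: "C (u p) (w' t) = 0" if "p < r" "t < s" for p t
    using that by (simp add: C_def Bu Au Aw' v')
  \<comment> \<open>\<open>Inl\<close> tags conditions from \<open>B\<close> and \<open>Inr\<close>
    those from \<open>C\<close>; indices below \<open>s\<close> are omitted because every
    \<open>u p\<close> satisfies them already.\<close>
  define E where "E = Inl ` {s..<t1} \<union> (Inr ` {s..<t2} :: (nat + nat) set)"
  have "finite E" by (simp add: E_def)
  have "card E \<le> (t1 - s) + (t2 - s)"
    unfolding E_def by (rule order.trans[OF card_Un_le]) (simp add: card_image)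
  then have "card E < r" using t1 t2 sr by linarith
  then obtain c where c: "\<exists>j<r. c j \<noteq> 0"
    and sol: "\<And>e. e \<in> E \<Longrightarrow> (\<Sum>j<r. (case e of Inl q \<Rightarrow> B (u j) (w1 q) | Inr q \<Rightarrow> C (u j) (w2 q)) * c j) = 0"
    using underdetermined_system[OF \<open>finite E\<close>, of r
        "\<lambda>e j. case e of Inl q \<Rightarrow> B (u j) (w1 q) | Inr q \<Rightarrow> C (u j) (w2 q)"] by blast
  define x where "x = (\<Sum>j<r. s1 (c j) (u j))"
  have xV: "x \<in> V" unfolding x_def
    using uV by (intro left.subspace_sum[OF V] left.subspace_scale[OF V]) auto
  have "B x (w1 q) = 0" if "q < t1" for q
  proof (cases "q < s")
    case True then show ?thesis unfolding x_def by (simp add: sum_left[OF B] t1 Bu)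
  next
    case False
    then show ?thesis using sol[of "Inl q"] that unfolding x_def E_def
      by (simp add: sum_left[OF B] mult.commute)
  qed
  then have Bx: "B x y = 0" if "y \<in> W" for y using rad1 xV that by blast
  have "C x (w2 q) = 0" if "q < t2" for q
  proof (cases "q < s")
    case True then show ?thesis unfolding x_def by (simp add: sum_left[OF C] t2 Cu)
  next
    case False
    then show ?thesis using sol[of "Inr q"] that unfolding x_def E_def
      by (simp add: sum_left[OF C] mult.commute)
  qed
  then have Cx: "C x y = 0" if "y \<in> W" for y using rad2 xV that by blast
  have "c q = 0" if q: "q < r" for q
  proof -
    have "A x (w q) = (\<Sum>j<r. c j * A (v j) (w q))"
      unfolding x_def using q by (simp add: sum_left[OF A] Au vp)
    also have "\<dots> = (\<Sum>j<r. if j = q then c q else 0)"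
      using dA q by (intro sum.cong) (auto simp: dual_families_def)
    finally have "A x (w q) = c q" using q by simp
    moreover have "A x (w q) = 0" using Bx[of "w q"] Cx[of "w q"] vp[OF q] by (simp add: C_def)
    ultimately show ?thesis by simp
  qed
  then show False using c by blast
qed

text \<open>A form of maximal rank \<open>t\<close> contributes its \<open>t\<close> vectors
  \<open>v p\<close>, and on its kernels all ranks are at most \<open>t div 2\<close>. The sizes
  \<open>t + t/2 + t/4 + ...\<close> add up to at most \<open>2 * t\<close>.\<close>

lemma determining_set:
  assumes "left.subspace V" "right.subspace W"
    and "\<forall>B\<in>F. \<forall>t v w. dual_families B V W t v w \<longrightarrow> t \<le> r"
  shows "\<exists>S\<subseteq>V. finite S \<and> card S \<le> 2 * r \<and>
    (\<forall>y\<in>W. (\<forall>B\<in>F. \<forall>x\<in>S. B x y = 0) \<longrightarrow> (\<forall>B\<in>F. \<forall>x\<in>V. B x y = 0))"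
  using assms
proof (induction r arbitrary: V W rule: less_induct)
  case (less r)
  note V = less.prems(1) and W = less.prems(2)
  define P where "P t \<longleftrightarrow> (\<exists>B v w. B \<in> F \<and> dual_families B V W t v w)" for t
  show ?case
  proof (cases "\<exists>t>0. P t")
    case False
    have "B x y = 0" if B: "B \<in> F" and x: "x \<in> V" and y: "y \<in> W" for B x y
    proof -
      have b: "\<forall>t v w. dual_families B V W t v w \<longrightarrow> t \<le> r" using less.prems(3) B by blast
      have "dual_families B V W 0 (\<lambda>_. x) (\<lambda>_. y)" by (simp add: dual_families_def)
      then obtain t v' w' where d: "dual_families B V W t v' w'"
        and rad: "\<forall>x\<in>V. (\<forall>q<t. B x (w' q) = 0) \<longrightarrow> (\<forall>y\<in>W. B x y = 0)"
        using extend_dual_families[OF B V W _ b] by blast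
      have "P t" using B d unfolding P_def by blast
      with False have "\<not> 0 < t" by metis
      then have "t = 0" by simp
      then show ?thesis using rad x y by blast
    qed
    then have "\<forall>y\<in>W. (\<forall>B\<in>F. \<forall>x\<in>{}. B x y = 0) \<longrightarrow> (\<forall>B\<in>F. \<forall>x\<in>V. B x y = 0)"
      by (intro ballI impI)
    moreover have "{} \<subseteq> V" "finite ({} :: 'b set)" "card ({} :: 'b set) \<le> 2 * r" by simp_all
    ultimately show ?thesis by (intro exI[of _ "{}"] conjI)
  next
    case True
    have Pr: "\<forall>t. P t \<longrightarrow> t \<le> r" using less.prems(3) unfolding P_def by blast
    with True obtain t where "P t" and t_max: "\<forall>t'. P t' \<longrightarrow> t' \<le> t"
      using bounded_has_greatest[of P] by blast
    then obtain A v w where A: "A \<in> F" and dA: "dual_families A V W t v w"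
      unfolding P_def by blast
    have "t \<le> r" using Pr \<open>P t\<close> by blast
    obtain t' where "0 < t'" "P t'" using True by blast
    then have "0 < t" using t_max by (metis less_le_trans)
    note t = \<open>0 < t\<close> \<open>t \<le> r\<close>
    define V0 where "V0 = {x \<in> V. \<forall>q<t. A x (w q) = 0}"
    define W0 where "W0 = {y \<in> W. \<forall>p<t. A (v p) y = 0}"
    have V0: "left.subspace V0"
      using V unfolding V0_def left.subspace_def by (auto simp: zero_left[OF A] add_left[OF A] scale_left[OF A])
    have W0: "right.subspace W0"
      using W unfolding W0_def right.subspace_def by (auto simp: zero_right[OF A] add_right[OF A] scale_right[OF A])
    have max_t: "\<forall>C\<in>F. \<forall>t' v w. dual_families C V W t' v w \<longrightarrow> t' \<le> t"
      using t_max unfolding P_def by blast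
    have "s \<le> t div 2" if "B \<in> F" "dual_families B V0 W0 s v' w'" for B s v' w'
      using rank_on_kernels[OF A that(1) V W max_t dA that(2)[unfolded V0_def W0_def]] by simp
    then have bound0: "\<forall>B\<in>F. \<forall>s v' w'. dual_families B V0 W0 s v' w' \<longrightarrow> s \<le> t div 2"
      by blast
    have "t div 2 < r" using t by linarith
    from less.IH[OF this V0 W0 bound0] obtain S0 where S0: "S0 \<subseteq> V0" "finite S0" "card S0 \<le> 2 * (t div 2)"
      and det0: "\<forall>y\<in>W0. (\<forall>B\<in>F. \<forall>x\<in>S0. B x y = 0) \<longrightarrow> (\<forall>B\<in>F. \<forall>x\<in>V0. B x y = 0)"
      by blast
    define S where "S = S0 \<union> v ` {..<t}"
    have "S \<subseteq> V" using S0(1) dA by (auto simp: S_def V0_def dual_families_def)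
    moreover have "finite S" using S0 by (simp add: S_def)
    moreover have "card S \<le> 2 * r"
    proof -
      have "card S \<le> card S0 + card (v ` {..<t})" unfolding S_def by (rule card_Un_le)
      also have "card (v ` {..<t}) \<le> t" using card_image_le[of "{..<t}" v] by simp
      finally show ?thesis using S0(3) t by linarith
    qed
    moreover have "\<forall>y\<in>W. (\<forall>B\<in>F. \<forall>x\<in>S. B x y = 0) \<longrightarrow> (\<forall>B\<in>F. \<forall>x\<in>V. B x y = 0)"
    proof (intro ballI impI)
      fix y B x
      assume y: "y \<in> W" and 0: "\<forall>B\<in>F. \<forall>x\<in>S. B x y = 0" and B: "B \<in> F" and x: "x \<in> V"
      have "\<forall>p<t. A (v p) y = 0" using bspec[OF 0 A] by (simp add: S_def)
      then have "y \<in> W0" using y by (simp add: W0_def)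
      moreover have "\<forall>B\<in>F. \<forall>x\<in>S0. B x y = 0" using 0 unfolding S_def by blast
      ultimately have *: "B x y = 0" if "x \<in> V0" for x using that B det0 by blast
      \<comment> \<open>Modulo the \<open>v p\<close>, which belong to \<open>S\<close>, every
        \<open>x\<close> can be moved into \<open>V0\<close>.\<close>
      define z where "z = x - (\<Sum>p<t. s1 (A x (w p)) (v p))"
      have "z \<in> V" unfolding z_def using x dA
        by (intro left.subspace_diff[OF V] left.subspace_sum[OF V] left.subspace_scale[OF V])
          (auto simp: dual_families_def)
      moreover have "A z (w q) = 0" if "q < t" for q
      proof -
        have "(\<Sum>p<t. A x (w p) * A (v p) (w q)) = (\<Sum>p<t. if p = q then A x (w q) else 0)"
          using dA that by (intro sum.cong) (auto simp: dual_families_def)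
        then show ?thesis unfolding z_def using that by (simp add: diff_left[OF A] sum_left[OF A])
      qed
      ultimately have "B z y = 0" using * by (simp add: V0_def)
      moreover have "B (v p) y = 0" if "p < t" for p using bspec[OF 0 B] that by (simp add: S_def)
      ultimately show "B x y = 0" unfolding z_def by (simp add: diff_left[OF B] sum_left[OF B])
    qed
    ultimately show ?thesis by (intro exI[of _ S] conjI)
  qed
qed

end

section \<open>Ranks of contractions of a tensor\<close>

definition trilin :: "nat \<Rightarrow> 'a::field tensor3 \<Rightarrow> (nat \<Rightarrow> 'a) \<Rightarrow> (nat \<Rightarrow> 'a) \<Rightarrow> (nat \<Rightarrow> 'a) \<Rightarrow> 'a" where
  "trilin n T u v w = (\<Sum>i<n. u i * (\<Sum>j<n. v j * (\<Sum>k<n. w k * T i j k)))"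

definition rotate_tensor :: "'a tensor3 \<Rightarrow> 'a tensor3" where
  "rotate_tensor T = (\<lambda>i j k. T k i j)"

text \<open>
  Some contraction of the first leg is a matrix of rank at least \<open>r\<close>; the other legs are reached
  by rotating the tensor.
\<close>

definition contracts :: "nat \<Rightarrow> 'a::field tensor3 \<Rightarrow> nat \<Rightarrow> bool" where
  "contracts n T r \<longleftrightarrow>
     (\<exists>u v w. \<forall>p<r. \<forall>q<r. trilin n T u (v p) (w q) = (if p = q then 1 else 0))"

text \<open>
  The flattening along the third leg has full rank.
\<close>

definition nondegenerate :: "nat \<Rightarrow> 'a::field tensor3 \<Rightarrow> bool" where
  "nondegenerate n T \<longleftrightarrow>
     (\<forall>w. (\<forall>i<n. \<forall>j<n. (\<Sum>k<n. T i j k * w k) = 0) \<longrightarrow> (\<forall>k<n. w k = 0))"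

lemma nondegenerateD:
  assumes "nondegenerate n T" "\<And>i j. i < n \<Longrightarrow> j < n \<Longrightarrow> (\<Sum>k<n. T i j k * w k) = 0" "k < n"
  shows "w k = 0"
  using assms unfolding nondegenerate_def by blast

lemma trilin_eq: "trilin n T u v w = (\<Sum>i<n. \<Sum>j<n. \<Sum>k<n. u i * v j * w k * T i j k)"
  by (simp add: trilin_def sum_distrib_left mult.assoc)

lemma trilin_rotate: "trilin n (rotate_tensor T) u v w = trilin n T w u v"
proof -
  have "trilin n (rotate_tensor T) u v w = (\<Sum>i<n. \<Sum>j<n. \<Sum>k<n. u i * v j * w k * T k i j)"
    by (simp add: trilin_eq rotate_tensor_def)
  also have "\<dots> = (\<Sum>i<n. \<Sum>k<n. \<Sum>j<n. u i * v j * w k * T k i j)"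
    by (intro sum.cong refl sum.swap)
  also have "\<dots> = (\<Sum>k<n. \<Sum>i<n. \<Sum>j<n. u i * v j * w k * T k i j)"
    by (rule sum.swap)
  finally show ?thesis by (simp add: trilin_eq mult.commute mult.left_commute)
qed

lemma rotate_thrice: "rotate_tensor (rotate_tensor (rotate_tensor T)) = T"
  by (simp add: rotate_tensor_def)

lemma trilin_add1: "trilin n T (u + u') v w = trilin n T u v w + trilin n T u' v w"
  by (simp add: trilin_def sum.distrib distrib_right)

lemma trilin_scale1: "trilin n T (\<lambda>i. c * u i) v w = c * trilin n T u v w"
  by (simp add: trilin_def sum_distrib_left mult.assoc)

lemma trilin_add2: "trilin n T u (v + v') w = trilin n T u v w + trilin n T u v' w"
  by (simp add: trilin_rotate[symmetric, of n T] trilin_add1)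

lemma trilin_scale2: "trilin n T u (\<lambda>i. c * v i) w = c * trilin n T u v w"
  by (simp add: trilin_rotate[symmetric, of n T] trilin_scale1)

lemma trilin_add3: "trilin n T u v (w + w') = trilin n T u v w + trilin n T u v w'"
  by (simp add: trilin_rotate[symmetric, of n T] trilin_add2)

lemma trilin_scale3: "trilin n T u v (\<lambda>i. c * w i) = c * trilin n T u v w"
  by (simp add: trilin_rotate[symmetric, of n T] trilin_scale2)

lemma trilin_coeff3: "trilin n T u v w = (\<Sum>k<n. (\<Sum>i<n. \<Sum>j<n. u i * v j * T i j k) * w k)"
proof -
  have "trilin n T u v w = trilin n (rotate_tensor T) v w u" by (simp add: trilin_rotate)
  also have "\<dots> = trilin n (rotate_tensor (rotate_tensor T)) w u v" by (simp add: trilin_rotate)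
  also have "\<dots> = (\<Sum>k<n. \<Sum>i<n. \<Sum>j<n. w k * u i * v j * T i j k)"
    by (simp add: trilin_eq rotate_tensor_def)
  also have "\<dots> = (\<Sum>k<n. (\<Sum>i<n. \<Sum>j<n. u i * v j * T i j k) * w k)"
    by (simp add: sum_distrib_left sum_distrib_right mult_ac)
  finally show ?thesis .
qed

lemma trilin_unit_vectors:
  assumes "i < n" "j < n"
  shows "trilin n T (\<lambda>x. if x = i then 1 else 0) (\<lambda>x. if x = j then 1 else 0) w = (\<Sum>k<n. T i j k * w k)"
  using assms by (simp add: trilin_def if_distrib[of "\<lambda>x. x * _"] mult.commute cong: if_cong)

lemma vector_space_fun: "vector_space (\<lambda>(c::'a::field) (f::nat \<Rightarrow> 'a) i. c * f i)"
  by unfold_locales (auto simp: fun_eq_iff algebra_simps)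

lemma bilinear_family_slices:
  "bilinear_family (\<lambda>c f i. c * f i) (\<lambda>c f i. c * f i) (range (trilin n (T::'a::field tensor3)))"
proof -
  interpret vector_space "\<lambda>(c::'a) (f::nat \<Rightarrow> 'a) i. c * f i" by (rule vector_space_fun)
  show ?thesis
  proof
    fix A B assume "A \<in> range (trilin n T)" "B \<in> range (trilin n T)"
    then obtain u u' where "A = trilin n T u" "B = trilin n T u'" by blast
    then have "(\<lambda>x y. A x y + B x y) = trilin n T (u + u')"
      by (simp add: fun_eq_iff trilin_add1)
    then show "(\<lambda>x y. A x y + B x y) \<in> range (trilin n T)" by blast
  qed (auto simp: trilin_add2 trilin_add3 trilin_scale2 trilin_scale3)
qed

text \<open>More than \<open>n\<close> vectors satisfy a nontrivial relation on their first
  \<open>n\<close> coordinates, and pairing it with \<open>w q\<close> reads off the coefficient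
  \<open>c q\<close>.\<close>

lemma contracts_le:
  assumes "contracts n (T::'a::field tensor3) r"
  shows "r \<le> n"
proof (rule ccontr)
  assume "\<not> r \<le> n"
  then have nr: "card {..<n} < r" by simp
  from assms obtain u v w
    where d: "\<And>p q. p < r \<Longrightarrow> q < r \<Longrightarrow> trilin n T u (v p) (w q) = (if p = q then 1 else 0)"
    unfolding contracts_def by blast
  obtain c where c: "\<exists>p<r. c p \<noteq> 0" and sol: "\<And>i. i < n \<Longrightarrow> (\<Sum>p<r. v p i * c p) = 0"
    using underdetermined_system[OF finite_lessThan nr, of "\<lambda>i p. v p i"] by auto
  interpret bilinear_family "\<lambda>c f i. c * f i" "\<lambda>c f i. c * f i" "range (trilin n T)"
    by (rule bilinear_family_slices)
  define x where "x = (\<Sum>p<r. (\<lambda>i. c p * v p i))"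
  have x: "x i = (\<Sum>p<r. v p i * c p)" for i
    unfolding x_def by (induction r) (simp_all add: mult.commute)
  have "c q = 0" if q: "q < r" for q
  proof -
    have "trilin n T u x (w q) = (\<Sum>p<r. c p * trilin n T u (v p) (w q))"
      unfolding x_def by (rule sum_left) simp
    also have "\<dots> = (\<Sum>p<r. if p = q then c q else 0)"
      using q by (intro sum.cong) (auto simp: d)
    finally have "trilin n T u x (w q) = c q" using q by simp
    moreover have "trilin n T u x (w q) = 0"
      by (simp add: trilin_def x sol)
    ultimately show ?thesis by simp
  qed
  then show False using c by blast
qed

text \<open>With the second argument fixed at \<open>v\<close>, the form in the other two is a slice
  of the rotated tensor and so has rank at most \<open>b\<close>. Its vanishing thus amounts to at
  most \<open>b\<close> linear conditions on \<open>w\<close>.\<close>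

lemma slice_radical:
  fixes T :: "'a::field tensor3"
  assumes "\<forall>r. contracts n (rotate_tensor T) r \<longrightarrow> r \<le> b"
  shows "\<exists>t\<le>b. \<exists>U. \<forall>w. (\<forall>q<t. trilin n T (U q) v w = 0) \<longrightarrow> (\<forall>u. trilin n T u v w = 0)"
proof -
  interpret bilinear_family "\<lambda>c f i. c * f i" "\<lambda>c f i. c * f i" "range (trilin n (rotate_tensor T))"
    by (rule bilinear_family_slices)
  have "t \<le> b" if "dual_families (trilin n (rotate_tensor T) v) UNIV UNIV t f g" for t f g
    using assms that by (auto simp: dual_families_def contracts_def)
  then have b: "\<forall>t f g. dual_families (trilin n (rotate_tensor T) v) UNIV UNIV t f g \<longrightarrow> t \<le> b"
    by blast
  have 0: "dual_families (trilin n (rotate_tensor T) v) UNIV UNIV 0 f g" for f g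
    by (simp add: dual_families_def)
  obtain t U where "t \<le> b"
    and "\<forall>w\<in>UNIV. (\<forall>q<t. trilin n (rotate_tensor T) v w (U q) = 0) \<longrightarrow>
      (\<forall>u\<in>UNIV. trilin n (rotate_tensor T) v w u = 0)"
    using extend_dual_families[OF _ left.subspace_UNIV left.subspace_UNIV 0 b] by blast
  then show ?thesis by (auto simp: trilin_rotate)
qed

text \<open>A determining set has at most \<open>2 * a\<close> vectors \<open>v\<close>, and each
  imposes at most \<open>b\<close> conditions on \<open>w\<close>. With fewer than \<open>n\<close>
  conditions in all, some nonzero \<open>w\<close> would be annihilated by the whole tensor.\<close>

lemma contraction_rank_product:
  fixes T :: "'a::field tensor3"
  assumes nd: "nondegenerate n T"
    and a: "\<forall>r. contracts n T r \<longrightarrow> r \<le> a"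
    and b: "\<forall>r. contracts n (rotate_tensor T) r \<longrightarrow> r \<le> b"
  shows "n \<le> 2 * a * b"
proof (rule ccontr)
  assume "\<not> n \<le> 2 * a * b"
  then have ab: "2 * a * b < n" by simp
  interpret bilinear_family "\<lambda>c f i. c * f i" "\<lambda>c f i. c * f i" "range (trilin n T)"
    by (rule bilinear_family_slices)
  have "t \<le> a" if "dual_families (trilin n T u) UNIV UNIV t f g" for u t f g
    using a that by (auto simp: dual_families_def contracts_def)
  then have "\<forall>B\<in>range (trilin n T). \<forall>t f g. dual_families B UNIV UNIV t f g \<longrightarrow> t \<le> a"
    by blast
  from determining_set[OF left.subspace_UNIV left.subspace_UNIV this]
  obtain S where S: "finite S" "card S \<le> 2 * a"
    and det: "\<And>w. (\<forall>u. \<forall>v\<in>S. trilin n T u v w = 0) \<Longrightarrow> (\<forall>u v. trilin n T u v w = 0)"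
    by auto
  obtain t U where t: "\<And>v. t v \<le> b"
    and rad: "\<And>v w. (\<forall>q<t v. trilin n T (U v q) v w = 0) \<Longrightarrow> (\<forall>u. trilin n T u v w = 0)"
    using slice_radical[OF b] by metis
  define E where "E = Sigma S (\<lambda>v. {..<t v})"
  have E: "finite E" unfolding E_def using S by simp
  have "card E = (\<Sum>v\<in>S. t v)" unfolding E_def using S by simp
  also have "\<dots> \<le> card S * b" using sum_bounded_above[of S t b] t by simp
  also have "\<dots> \<le> 2 * a * b" using S(2) by simp
  finally have "card E < n" using ab by simp
  from underdetermined_system[OF E this, of "\<lambda>(v, q) k. \<Sum>i<n. \<Sum>j<n. U v q i * v j * T i j k"]
  obtain w where w: "\<exists>k<n. w k \<noteq> 0"
    and sol: "\<forall>e\<in>E. (\<Sum>k<n. (case e of (v, q) \<Rightarrow> \<lambda>k. \<Sum>i<n. \<Sum>j<n. U v q i * v j * T i j k) k * w k) = 0"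
    by blast
  have "trilin n T (U v q) v w = 0" if "v \<in> S" "q < t v" for v q
    using bspec[OF sol, of "(v, q)"] that by (simp add: trilin_coeff3 E_def)
  then have "\<forall>u v. trilin n T u v w = 0" using det rad by blast
  then have "(\<Sum>k<n. T i j k * w k) = 0" if "i < n" "j < n" for i j
    using trilin_unit_vectors[OF that, of T w] by simp
  then show False using nondegenerateD[OF nd] w by blast
qed

text \<open>A maximal independent set of columns has \<open>n\<close> elements and forms an
  invertible square matrix whose transpose annihilates \<open>u\<close>.\<close>

lemma full_row_rank_imp_injective:
  assumes M: "(M :: 'a::field mat) \<in> carrier_mat n nc" and rank: "vec_space.rank n M = n"
    and u: "\<And>c. c < nc \<Longrightarrow> (\<Sum>i<n. M $$ (i, c) * u i) = 0" and i: "i < n"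
  shows "u i = 0"
proof -
  interpret vec_space "TYPE('a)" n .
  obtain S where S: "maximal S (\<lambda>T. T \<subseteq> set (cols M) \<and> lin_indpt T)" "finite S"
    using maximal_exists_superset[of "set (cols M)" "\<lambda>T. T \<subseteq> set (cols M) \<and> lin_indpt T" "{}"]
      lindep_span by (auto simp: lin_dep_def)
  then have SM: "S \<subseteq> set (cols M)" and li: "lin_indpt S" by (auto simp: maximal_def)
  have cardS: "card S = n" using rank_card_indpt[OF M S(1)] rank by simp
  obtain xs where xs: "set xs = S" "distinct xs" "length xs = n"
    using finite_distinct_list[OF S(2)] cardS distinct_card by metis
  have xs_carrier: "set xs \<subseteq> carrier_vec n" using SM xs(1) cols_dim[of M] M by auto
  define A where "A = mat_of_cols n xs"
  have A: "A \<in> carrier_mat n n" unfolding A_def using xs(3) by auto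
  have cA: "cols A = xs" unfolding A_def using xs_carrier by (rule cols_mat_of_cols)
  have "rank A = n" using lin_indpt_full_rank[OF A] cA xs li by simp
  then have "det A \<noteq> 0" using det_rank_iff[OF A] by simp
  then have dT: "det (transpose_mat A) \<noteq> 0" using det_transpose[OF A] by simp
  have "transpose_mat A *\<^sub>v vec n u = 0\<^sub>v n"
  proof (rule eq_vecI)
    fix q assume "q < dim_vec (0\<^sub>v n :: 'a vec)"
    then have q: "q < n" by simp
    then have "xs ! q \<in> set (cols M)" using xs SM by (metis nth_mem subsetD)
    then obtain c where c: "c < nc" "xs ! q = col M c"
      using M by (metis carrier_matD(2) cols_length cols_nth in_set_conv_nth)
    have "col A q = col M c" using cA c(2) q A by (metis carrier_matD(2) cols_nth)
    then have "(transpose_mat A *\<^sub>v vec n u) $ q = (\<Sum>i<n. M $$ (i, c) * u i)"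
      using q A c(1) M by (simp add: scalar_prod_def atLeast0LessThan)
    then show "(transpose_mat A *\<^sub>v vec n u) $ q = 0\<^sub>v n $ q" using u[OF c(1)] q by simp
  qed (use A in auto)
  then have "vec n u = 0\<^sub>v n"
    using det_0_iff_vec_prod_zero_field[of "transpose_mat A" n] iffD2[OF transpose_carrier_mat A] dT
      vec_carrier[of n u] by blast
  then show ?thesis using i by (metis index_vec index_zero_vec(1))
qed

lemma concise_imp_nondegenerate:
  assumes "concise n T"
  shows "nondegenerate n T" "nondegenerate n (rotate_tensor T)"
    "nondegenerate n (rotate_tensor (rotate_tensor T))"
proof -
  have flat: "\<forall>k<n. w k = 0"
    if "vec_space.rank n (mat n (n * n) (\<lambda>(k, c). f (c div n) (c mod n) k)) = n"
      and 0: "\<forall>i<n. \<forall>j<n. (\<Sum>k<n. f i j k * w k) = 0" for f :: "'a tensor3" and w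
  proof (intro allI impI)
    fix k assume k: "k < n"
    have "(\<Sum>k<n. mat n (n * n) (\<lambda>(k, c). f (c div n) (c mod n) k) $$ (k, c) * w k) = 0"
      if "c < n * n" for c
    proof -
      have "c div n < n" "c mod n < n" using that k by (auto simp: less_mult_imp_div_less)
      then show ?thesis using that 0 by simp
    qed
    from full_row_rank_imp_injective[OF mat_carrier that(1) this k] show "w k = 0" .
  qed
  show "nondegenerate n T"
    using assms flat[of T] unfolding nondegenerate_def concise_def flattening3_def by blast
  show "nondegenerate n (rotate_tensor T)"
    using assms flat[of "rotate_tensor T"]
    unfolding nondegenerate_def concise_def flattening1_def rotate_tensor_def by blast
  \<comment> \<open>The double rotation lists the two grouped legs in the opposite order from
    \<open>flattening2\<close>.\<close>
  have "(\<forall>i<n. \<forall>j<n. (\<Sum>k<n. T j k i * w k) = 0) \<longleftrightarrow> (\<forall>i<n. \<forall>j<n. (\<Sum>k<n. T i k j * w k) = 0)" for w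
    by blast
  then show "nondegenerate n (rotate_tensor (rotate_tensor T))"
    using assms flat[of "\<lambda>i j k. T i k j"]
    unfolding nondegenerate_def concise_def flattening2_def rotate_tensor_def by blast
qed

section \<open>Nondegeneracy of Kronecker powers\<close>

lemma sum_div_mod: "(\<Sum>k<N * n. f (k div n) (k mod n)) = (\<Sum>c<N. \<Sum>d<n. f c d)"
  for f :: "nat \<Rightarrow> nat \<Rightarrow> 'a::comm_monoid_add"
proof -
  have "(\<Sum>k<N * n. f (k div n) (k mod n)) = (\<Sum>c<N. \<Sum>k=c * n..<c * n + n. f (k div n) (k mod n))"
    by (simp add: sum.nat_group)
  also have "\<dots> = (\<Sum>c<N. \<Sum>d<n. f c d)"
  proof (rule sum.cong[OF refl])
    fix c
    have "(\<Sum>k=c * n..<c * n + n. f (k div n) (k mod n)) = (\<Sum>d=0..<n. f ((d + c * n) div n) ((d + c * n) mod n))"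
      using sum.shift_bounds_nat_ivl[of "\<lambda>k. f (k div n) (k mod n)" 0 "c * n" n] by (simp add: add.commute)
    then show "(\<Sum>k=c * n..<c * n + n. f (k div n) (k mod n)) = (\<Sum>d<n. f c d)"
      by (simp add: atLeast0LessThan)
  qed
  finally show ?thesis .
qed

lemma sum_div_mod_product:
  "(\<Sum>k<N * n. f (k div n) * g (k mod n)) = (\<Sum>c<N. f c) * (\<Sum>d<n. g d)"
  for f g :: "nat \<Rightarrow> 'a::comm_semiring_0"
  by (simp add: sum_div_mod[of "\<lambda>c d. f c * g d"] sum_product)

text \<open>The factors are cancelled one at a time: for fixed \<open>i\<close>, \<open>j\<close>
  the contractions of the blocks of \<open>w\<close> with \<open>T\<close> form a vector annihilated
  by \<open>S\<close>, hence vanish, and then each block is annihilated by \<open>T\<close>.\<close>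

lemma nondegenerate_kronecker:
  assumes S: "nondegenerate N S" and T: "nondegenerate n T"
  shows "nondegenerate (N * n) (kronecker n S T)"
  unfolding nondegenerate_def
proof (intro allI impI)
  fix w k
  assume 0: "\<forall>i<N * n. \<forall>j<N * n. (\<Sum>k<N * n. kronecker n S T i j k * w k) = 0" and k: "k < N * n"
  have idx: "a * n + b < N * n" "(a * n + b) div n = a" "(a * n + b) mod n = b" if "a < N" "b < n" for a b
  proof -
    have "a * n + b < Suc a * n" using that by simp
    also have "\<dots> \<le> N * n" using that by (intro mult_le_mono1) simp
    finally show "a * n + b < N * n" .
  qed (use that in auto)
  have x: "(\<Sum>d<n. T i j d * w (c * n + d)) = 0" if ij: "i < n" "j < n" and c: "c < N" for i j c
  proof -
    have "(\<Sum>c<N. S i' j' c * (\<Sum>d<n. T i j d * w (c * n + d))) = 0" if i'j': "i' < N" "j' < N" for i' j'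
    proof -
      have "(\<Sum>k<N * n. kronecker n S T (i' * n + i) (j' * n + j) k * w k) = 0"
        using 0 idx(1) ij i'j' by blast
      also have "(\<Sum>k<N * n. kronecker n S T (i' * n + i) (j' * n + j) k * w k)
        = (\<Sum>k<N * n. S i' j' (k div n) * T i j (k mod n) * w ((k div n) * n + k mod n))"
        using ij i'j' by (simp add: kronecker_def idx)
      also have "\<dots> = (\<Sum>c<N. \<Sum>d<n. S i' j' c * T i j d * w (c * n + d))"
        by (rule sum_div_mod)
      finally show ?thesis by (simp add: sum_distrib_left mult.assoc)
    qed
    from nondegenerateD[where w = "\<lambda>c. \<Sum>d<n. T i j d * w (c * n + d)", OF S this c] show ?thesis .
  qed
  have "n > 0" using k by (cases n) auto
  then have kk: "k div n < N" "k mod n < n" using k by (auto simp: less_mult_imp_div_less)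
  from nondegenerateD[where w = "\<lambda>d. w (k div n * n + d)", OF T x[OF _ _ kk(1)] kk(2)]
  show "w k = 0" by simp
qed

lemma nondegenerate_power: "nondegenerate n T \<Longrightarrow> nondegenerate (n ^ m) (kronecker_power n T m)"
proof (induction m)
  case 0 show ?case by (simp add: nondegenerate_def)
next
  case (Suc m)
  then show ?case using nondegenerate_kronecker[of "n ^ m" _ n T] by (simp add: mult.commute)
qed

lemma rotate_kronecker_power: "rotate_tensor (kronecker_power n T m) = kronecker_power n (rotate_tensor T) m"
proof (induction m)
  case (Suc m)
  then show ?case by (simp add: fun_eq_iff kronecker_def rotate_tensor_def)
qed (simp add: rotate_tensor_def)

definition max_contraction :: "nat \<Rightarrow> 'a::field tensor3 \<Rightarrow> nat" where
  "max_contraction n T = Max {r. contracts n T r}"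

lemma max_contraction:
  fixes T :: "'a::field tensor3"
  shows "contracts n T (max_contraction n T)" "contracts n T r \<Longrightarrow> r \<le> max_contraction n T"
proof -
  have fin: "finite {r. contracts n T r}"
    by (rule finite_subset[of _ "{..n}"]) (auto dest: contracts_le)
  have "contracts n T 0" by (simp add: contracts_def)
  then have "{r. contracts n T r} \<noteq> {}" by blast
  then show "contracts n T (max_contraction n T)"
    unfolding max_contraction_def using Max_in[OF fin] by blast
  show "contracts n T r \<Longrightarrow> r \<le> max_contraction n T"
    unfolding max_contraction_def using Max_ge[OF fin] by blast
qed

lemma max_contraction_product:
  assumes "nondegenerate n T"
  shows "n \<le> 2 * max_contraction n T * max_contraction n (rotate_tensor T)"
  using contraction_rank_product[OF assms] max_contraction(2) by blast

section \<open>Edge-disjoint triangles\<close>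

lemma pigeonhole_fibre:
  assumes "finite A" "finite K" "f ` A \<subseteq> K"
  shows "\<exists>y. card A \<le> card {x \<in> A. f x = y} * card K"
proof (cases "A = {}")
  case False
  define M where "M = Max ((\<lambda>y. card {x \<in> A. f x = y}) ` K)"
  have fin: "finite ((\<lambda>y. card {x \<in> A. f x = y}) ` K)" using assms by simp
  have "K \<noteq> {}" using False assms(3) by auto
  then obtain y where y: "M = card {x \<in> A. f x = y}"
    using Max_in[OF fin] unfolding M_def by auto
  have "A = (\<Union>y\<in>K. {x \<in> A. f x = y})" using assms(3) by auto
  then have "card A \<le> (\<Sum>y\<in>K. card {x \<in> A. f x = y})"
    using card_UN_le[OF assms(2), of "\<lambda>y. {x \<in> A. f x = y}"] by simp
  also have "\<dots> \<le> (\<Sum>y\<in>K. M)"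
    by (rule sum_mono) (use Max_ge[OF fin] in \<open>auto simp: M_def\<close>)
  finally show ?thesis unfolding y by (intro exI[of _ y]) (simp add: mult.commute)
qed simp

text \<open>
  \<open>R\<close> triangles in the complete tripartite graph with parts \<open>{..<a}\<^sup>k\<close>, \<open>{..<b}\<^sup>k\<close>, \<open>{..<c}\<^sup>k\<close> such that
  three edges chosen from the triangles \<open>s\<close>, \<open>p\<close>, \<open>q\<close> only close up if \<open>p = q = s\<close>.
\<close>

definition disjoint_triangles :: "nat \<Rightarrow> nat \<Rightarrow> nat \<Rightarrow> nat \<Rightarrow> nat \<Rightarrow> bool" where
  "disjoint_triangles k a b c R \<longleftrightarrow>
     (\<exists>x y z :: nat \<Rightarrow> nat \<Rightarrow> nat.
        (\<forall>p<R. \<forall>l<k. x p l < a \<and> y p l < b \<and> z p l < c) \<and>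
        (\<forall>p<R. \<forall>q<R. \<forall>s<R. (\<forall>l<k. x q l = x s l \<and> y p l = y s l \<and> z p l = z q l) \<longrightarrow> p = q \<and> q = s))"

lemma disjoint_triangles_rotate:
  assumes "disjoint_triangles k a b c R"
  shows "disjoint_triangles k b c a R"
proof -
  from assms obtain x y z :: "nat \<Rightarrow> nat \<Rightarrow> nat"
    where 1: "\<forall>p<R. \<forall>l<k. x p l < a \<and> y p l < b \<and> z p l < c"
      and 2: "\<forall>p<R. \<forall>q<R. \<forall>s<R. (\<forall>l<k. x q l = x s l \<and> y p l = y s l \<and> z p l = z q l) \<longrightarrow> p = q \<and> q = s"
    unfolding disjoint_triangles_def by (elim exE conjE)
  show ?thesis unfolding disjoint_triangles_def
  proof (rule exI[of _ y], rule exI[of _ z], rule exI[of _ x], intro conjI allI impI)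
    fix p q s
    assume *: "p < R" "q < R" "s < R" "\<forall>l<k. y q l = y s l \<and> z p l = z s l \<and> x p l = x q l"
    have "q = s \<and> s = p" using 2[rule_format, of s p q] * by auto
    then show "p = q" "q = s" by auto
  qed (use 1 in auto)
qed

text \<open>The triangles are \<open>(x, y, x + y)\<close>; since \<open>x + y\<close> is at most
  \<open>a + b - 2\<close>, it fits below \<open>c\<close>. Fixing both components of
  \<open>f\<close> makes the sum of each one-edge polynomial in the identity for
  \<open>(x + y - z)\<^sup>2\<close> constant over the fibre, and these constants cancel. As
  \<open>f\<close> takes only polynomially many values in \<open>k\<close>, some fibre keeps almost
  all pairs.\<close>

lemma strassen_triangles:
  assumes a: "0 < a" and b: "0 < b" and c: "a + b \<le> Suc c"
  shows "\<exists>R. disjoint_triangles k a b c R \<and> (a * b) ^ k \<le> R * (Suc (3 * k * (a + b)\<^sup>2))\<^sup>2"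
proof -
  \<comment> \<open>Extensional functions make agreement below \<open>k\<close> the same as
    equality, as needed to recover \<open>p\<close> from its triangle.\<close>
  define X where "X = ({..<k} \<rightarrow>\<^sub>E {..<a}) \<times> ({..<k} \<rightarrow>\<^sub>E {..<b})"
  define f :: "(nat \<Rightarrow> nat) \<times> (nat \<Rightarrow> nat) \<Rightarrow> nat \<times> nat"
    where "f = (\<lambda>(x, y). (\<Sum>l<k. (x l)\<^sup>2 + 2 * x l * y l, \<Sum>l<k. (y l)\<^sup>2 + 2 * x l * y l))"
  define m where "m = 3 * k * (a + b)\<^sup>2"
  have finX: "finite X" unfolding X_def by (intro finite_cartesian_product finite_PiE) auto
  have cardX: "card X = (a * b) ^ k"
    unfolding X_def by (simp add: card_cartesian_product card_PiE power_mult_distrib)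
  have "f ` X \<subseteq> {..m} \<times> {..m}"
  proof
    fix e assume "e \<in> f ` X"
    then obtain x y where e: "e = f (x, y)"
      and xy: "\<And>l. l < k \<Longrightarrow> x l < a" "\<And>l. l < k \<Longrightarrow> y l < b"
      unfolding X_def by auto
    have le: "u\<^sup>2 + 2 * u' * v' \<le> 3 * (a + b)\<^sup>2" if "u \<le> a + b" "u' \<le> a + b" "v' \<le> a + b" for u u' v'
    proof -
      have "u\<^sup>2 \<le> (a + b)\<^sup>2" using that by (simp add: power_mono)
      moreover have "u' * v' \<le> (a + b)\<^sup>2" unfolding power2_eq_square using that by (intro mult_le_mono)
      ultimately show ?thesis by linarith
    qed
    have "(\<Sum>l<k. (x l)\<^sup>2 + 2 * x l * y l) \<le> (\<Sum>l<k. 3 * (a + b)\<^sup>2)"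
      using xy by (intro sum_mono le) fastforce+
    moreover have "(\<Sum>l<k. (y l)\<^sup>2 + 2 * x l * y l) \<le> (\<Sum>l<k. 3 * (a + b)\<^sup>2)"
      using xy by (intro sum_mono le) fastforce+
    ultimately show "e \<in> {..m} \<times> {..m}" unfolding e f_def m_def by simp
  qed
  then obtain \<alpha>\<beta> where pigeon: "card X \<le> card {e \<in> X. f e = \<alpha>\<beta>} * card ({..m} \<times> {..m})"
    using pigeonhole_fibre[OF finX, of "{..m} \<times> {..m}" f] by auto
  define \<Phi> where "\<Phi> = {e \<in> X. f e = \<alpha>\<beta>}"
  have fin\<Phi>: "finite \<Phi>" unfolding \<Phi>_def using finX by simp
  obtain g where g: "bij_betw g {0..<card \<Phi>} \<Phi>"
    using ex_bij_betw_nat_finite[OF fin\<Phi>] by blast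
  define x where "x p = fst (g p)" for p
  define y where "y p = snd (g p)" for p
  define z where "z p l = x p l + y p l" for p l
  have gX: "g p \<in> X" and gf: "f (g p) = \<alpha>\<beta>" if "p < card \<Phi>" for p
    using bij_betw_apply[OF g, of p] that unfolding \<Phi>_def by simp_all
  have PiE: "x p \<in> {..<k} \<rightarrow>\<^sub>E {..<a}" "y p \<in> {..<k} \<rightarrow>\<^sub>E {..<b}" if "p < card \<Phi>" for p
    using gX[OF that] unfolding X_def x_def y_def by (simp_all only: mem_Times_iff)
  have fg: "(\<Sum>l<k. (x p l)\<^sup>2 + 2 * x p l * y p l) = fst \<alpha>\<beta>"
    "(\<Sum>l<k. (y p l)\<^sup>2 + 2 * x p l * y p l) = snd \<alpha>\<beta>" if "p < card \<Phi>" for p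
    using gf[OF that, symmetric] unfolding x_def y_def by (simp_all add: f_def case_prod_beta)
  have eqI: "p = q" if pq: "p < card \<Phi>" "q < card \<Phi>"
    and eq: "\<And>l. l < k \<Longrightarrow> x p l = x q l" "\<And>l. l < k \<Longrightarrow> y p l = y q l" for p q
  proof -
    have "x p = x q" using PiE(1)[OF pq(1)] PiE(1)[OF pq(2)] by (rule PiE_ext) (use eq in auto)
    moreover have "y p = y q" using PiE(2)[OF pq(1)] PiE(2)[OF pq(2)] by (rule PiE_ext) (use eq in auto)
    ultimately have "g p = g q" by (simp add: x_def y_def prod_eq_iff)
    then show ?thesis using g pq by (auto simp: bij_betw_def inj_on_def)
  qed
  have "disjoint_triangles k a b c (card \<Phi>)"
    unfolding disjoint_triangles_def
  proof (rule exI[of _ x], rule exI[of _ y], rule exI[of _ z], intro conjI allI impI)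
    fix p l assume p: "p < card \<Phi>" and l: "l < k"
    show "x p l < a" "y p l < b" using PiE[OF p] l by auto
    then show "z p l < c" using c by (simp add: z_def)
  next
    fix p q s
    assume p: "p < card \<Phi>" and q: "q < card \<Phi>" and s: "s < card \<Phi>"
      and eq: "\<forall>l<k. x q l = x s l \<and> y p l = y s l \<and> z p l = z q l"
    define D where "D l = (int (x s l) + int (y s l) - int (z p l))\<^sup>2" for l
    \<comment> \<open>With \<open>(x, y, z)\<close> the triangle at hand, \<open>(x + y - z)\<^sup>2\<close> is the sum of \<open>x\<^sup>2 + 2xy\<close>, \<open>y\<^sup>2 - 2yz\<close>
      and \<open>z\<^sup>2 - 2zx\<close>, each of which sees only one edge and so can be evaluated in \<open>s\<close>, \<open>p\<close>
      and \<open>q\<close> respectively.\<close>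
    have D: "D l = int ((x s l)\<^sup>2 + 2 * x s l * y s l) - int ((y p l)\<^sup>2 + 2 * x p l * y p l)
      + (int ((y q l)\<^sup>2 + 2 * x q l * y q l) - int ((x q l)\<^sup>2 + 2 * x q l * y q l))" if "l < k" for l
    proof -
      have "x q l = x s l" "y p l = y s l" "z p l = z q l" using eq that by auto
      then have e: "x q l = x s l" "y p l = y s l" "x p l + y p l = x q l + y q l"
        by (auto simp: z_def)
      then have xp: "int (x p l) = int (x s l) + int (y q l) - int (y s l)" by linarith
      show ?thesis
        unfolding D_def z_def of_nat_add of_nat_mult of_nat_power xp e(1,2)
        by (simp add: power2_eq_square algebra_simps)
    qed
    have "(\<Sum>l<k. D l) = int (\<Sum>l<k. (x s l)\<^sup>2 + 2 * x s l * y s l) - int (\<Sum>l<k. (y p l)\<^sup>2 + 2 * x p l * y p l)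
      + (int (\<Sum>l<k. (y q l)\<^sup>2 + 2 * x q l * y q l) - int (\<Sum>l<k. (x q l)\<^sup>2 + 2 * x q l * y q l))"
      by (simp only: of_nat_sum sum_subtractf[symmetric] sum.distrib[symmetric]) (simp add: D)
    also have "\<dots> = 0" using p q s by (simp only: fg)
    finally have "(\<Sum>l<k. D l) = 0" .
    then have D0: "D l = 0" if "l < k" for l
      using sum_nonneg_eq_0_iff[of "{..<k}" D] that by (auto simp: D_def)
    have z: "z p l = x s l + y s l" if "l < k" for l
    proof -
      have "int (x s l) + int (y s l) - int (z p l) = 0" using D0[OF that] by (simp add: D_def)
      then show ?thesis by linarith
    qed
    \<comment> \<open>Now \<open>z p = x s + y s\<close>, and any two coordinates of a triangle
      determine the third.\<close>
    show "p = q"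
    proof (rule eqI[OF p q])
      fix l assume l: "l < k"
      have *: "x q l = x s l" "y p l = y s l" "z p l = z q l" using eq l by auto
      show "x p l = x q l" "y p l = y q l" using z[OF l] * by (simp_all add: z_def)
    qed
    show "q = s"
    proof (rule eqI[OF q s])
      fix l assume l: "l < k"
      have *: "x q l = x s l" "y p l = y s l" "z p l = z q l" using eq l by auto
      show "x q l = x s l" "y q l = y s l" using z[OF l] * by (simp_all add: z_def)
    qed
  qed
  moreover have "(a * b) ^ k \<le> card \<Phi> * (Suc m)\<^sup>2"
    using pigeon unfolding cardX \<Phi>_def by (simp add: card_cartesian_product power2_eq_square)
  ultimately show ?thesis unfolding m_def by blast
qed

lemma disjoint_triangles_mono:
  assumes "disjoint_triangles k a b c R" "a \<le> a'" "b \<le> b'" "c \<le> c'"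
  shows "disjoint_triangles k a' b' c' R"
proof -
  from assms(1) obtain x y z :: "nat \<Rightarrow> nat \<Rightarrow> nat"
    where 1: "\<forall>p<R. \<forall>l<k. x p l < a \<and> y p l < b \<and> z p l < c"
      and 2: "\<forall>p<R. \<forall>q<R. \<forall>s<R. (\<forall>l<k. x q l = x s l \<and> y p l = y s l \<and> z p l = z q l) \<longrightarrow> p = q \<and> q = s"
    unfolding disjoint_triangles_def by (elim exE conjE)
  have "\<forall>p<R. \<forall>l<k. x p l < a' \<and> y p l < b' \<and> z p l < c'"
    using 1 assms(2-4) by (meson less_le_trans)
  with 2 show ?thesis unfolding disjoint_triangles_def by blast
qed

text \<open>Halving two of the side lengths makes room for their sums in the third.\<close>

lemma disjoint_triangles_max_last:
  assumes "0 < a" "0 < b" "a \<le> c" "b \<le> c"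
  shows "\<exists>R. disjoint_triangles k a b c R \<and> a * b \<le> 4 * (Suc a div 2 * (Suc b div 2)) \<and>
    (Suc a div 2 * (Suc b div 2)) ^ k \<le> R * (Suc (3 * k * (a + b + c)\<^sup>2))\<^sup>2"
proof -
  \<comment> \<open>Rounding up keeps both halves positive and still fits, because \<open>a\<close>
    and \<open>b\<close> are at most \<open>c\<close>.\<close>
  have "0 < Suc a div 2" "0 < Suc b div 2" "Suc a div 2 + Suc b div 2 \<le> Suc c"
    using assms by linarith+
  from strassen_triangles[OF this, of k] obtain R
    where R: "disjoint_triangles k (Suc a div 2) (Suc b div 2) c R"
      and le: "(Suc a div 2 * (Suc b div 2)) ^ k \<le> R * (Suc (3 * k * (Suc a div 2 + Suc b div 2)\<^sup>2))\<^sup>2"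
    by blast
  have "a \<le> 2 * (Suc a div 2)" "b \<le> 2 * (Suc b div 2)" by linarith+
  from mult_le_mono[OF this] have "a * b \<le> 4 * (Suc a div 2 * (Suc b div 2))" by simp
  moreover have "(Suc (3 * k * (Suc a div 2 + Suc b div 2)\<^sup>2))\<^sup>2 \<le> (Suc (3 * k * (a + b + c)\<^sup>2))\<^sup>2"
  proof -
    have "Suc a div 2 + Suc b div 2 \<le> a + b + c" using assms by linarith
    then have "(Suc a div 2 + Suc b div 2)\<^sup>2 \<le> (a + b + c)\<^sup>2" by (rule power_mono) simp
    then show ?thesis by (intro power_mono Suc_leI le_imp_less_Suc mult_le_mono) simp_all
  qed
  then have "(Suc a div 2 * (Suc b div 2)) ^ k \<le> R * (Suc (3 * k * (a + b + c)\<^sup>2))\<^sup>2"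
    using le by (meson le_trans mult_le_mono2)
  moreover have "disjoint_triangles k a b c R"
    by (rule disjoint_triangles_mono[OF R]) (use assms in linarith)+
  ultimately show ?thesis by blast
qed

text \<open>Rotation puts the largest side last; \<open>N\<close> is bounded by all three products
  because any pair may be the one that remains. The error term uses \<open>a + b + c\<close> so as
  to be invariant under rotation.\<close>

lemma many_disjoint_triangles:
  assumes pos: "0 < a" "0 < b" "0 < c" and N: "N \<le> a * b" "N \<le> b * c" "N \<le> c * a"
  shows "\<exists>R. disjoint_triangles k a b c R \<and> N ^ k \<le> 4 ^ k * R * (Suc (3 * k * (a + b + c)\<^sup>2))\<^sup>2"
proof -
  have *: "\<exists>R. disjoint_triangles k a b c R \<and> N ^ k \<le> 4 ^ k * R * (Suc (3 * k * (a + b + c)\<^sup>2))\<^sup>2"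
    if pos: "0 < a" "0 < b" and le: "a \<le> c" "b \<le> c" and N: "N \<le> a * b" for a b c
  proof -
    from disjoint_triangles_max_last[OF pos le, of k] obtain R where R: "disjoint_triangles k a b c R"
      and ab: "a * b \<le> 4 * (Suc a div 2 * (Suc b div 2))"
      and pow: "(Suc a div 2 * (Suc b div 2)) ^ k \<le> R * (Suc (3 * k * (a + b + c)\<^sup>2))\<^sup>2"
      by blast
    have "N ^ k \<le> (4 * (Suc a div 2 * (Suc b div 2))) ^ k"
      using N ab by (intro power_mono) auto
    also have "\<dots> = 4 ^ k * (Suc a div 2 * (Suc b div 2)) ^ k" by (rule power_mult_distrib)
    also have "\<dots> \<le> 4 ^ k * (R * (Suc (3 * k * (a + b + c)\<^sup>2))\<^sup>2)" using pow by (rule mult_le_mono2)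
    finally show ?thesis using R by (metis mult.assoc)
  qed
  consider "a \<le> c" "b \<le> c" | "b \<le> a" "c \<le> a" | "c \<le> b" "a \<le> b" by linarith
  then show ?thesis
  proof cases
    case 1 then show ?thesis using *[of a b c] pos N by simp
  next
    case 2
    then obtain R where "disjoint_triangles k b c a R"
      "N ^ k \<le> 4 ^ k * R * (Suc (3 * k * (b + c + a)\<^sup>2))\<^sup>2"
      using *[of b c a] pos N by auto
    moreover have "b + c + a = a + b + c" by simp
    ultimately show ?thesis using disjoint_triangles_rotate by metis
  next
    case 3
    then obtain R where "disjoint_triangles k c a b R"
      "N ^ k \<le> 4 ^ k * R * (Suc (3 * k * (c + a + b)\<^sup>2))\<^sup>2"
      using *[of c a b] pos N by auto
    moreover have "c + a + b = a + b + c" by simp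
    ultimately show ?thesis using disjoint_triangles_rotate by metis
  qed
qed

section \<open>Subrank of Kronecker powers\<close>

text \<open>Fekete's lemma. That every quotient lies below \<open>L\<close> is recorded because it
  lets a bound on a subsequence bound the limit.\<close>

lemma superadditive_limit:
  fixes g :: "nat \<Rightarrow> real"
  assumes nonneg: "\<And>m. 0 \<le> g m" and bound: "\<And>m. g m \<le> C * real m"
    and super: "\<And>m k. g m + g k \<le> g (m + k)"
  shows "\<exists>L. (\<lambda>m. g m / real m) \<longlonglongrightarrow> L \<and> (\<forall>m>0. g m / real m \<le> L)"
proof -
  define L where "L = (SUP m\<in>{0<..}. g m / real m)"
  have bdd: "bdd_above ((\<lambda>m. g m / real m) ` {0<..})"
    using bound by (intro bdd_aboveI[of _ C]) (auto simp: divide_le_eq)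
  have upper: "g m / real m \<le> L" if "m > 0" for m
    unfolding L_def using that by (intro cSUP_upper bdd) auto
  have mult: "real q * g M \<le> g (q * M)" for q M
  proof (induction q)
    case (Suc q)
    then show ?case using super[of M "q * M"] by (simp add: algebra_simps)
  qed (use nonneg in simp)
  have "(\<lambda>m. g m / real m) \<longlonglongrightarrow> L"
  proof (rule order_tendstoI)
    fix x assume "x < L"
    then obtain M where M: "M > 0" "x < g M / real M"
      unfolding L_def using less_cSUP_iff[OF _ bdd, of x] by auto
    \<comment> \<open>Division of \<open>m\<close> by \<open>M\<close> gives at least
      \<open>m / M - 1\<close> full blocks; the remainder contributes a nonnegative term.\<close>
    have lower: "g M / real M - g M / real m \<le> g m / real m" if m: "m > 0" for m
    proof -
      have "m < M * Suc (m div M)"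
        using M(1) dividend_less_times_div[of M m] by simp
      then have "real m < real M * (real (m div M) + 1)"
        by (metis of_nat_less_iff of_nat_mult of_nat_Suc add.commute)
      then have "real m / real M - 1 \<le> real (m div M)" using M(1) by (simp add: field_simps)
      then have "(real m / real M - 1) * g M \<le> real (m div M) * g M"
        using nonneg by (rule mult_right_mono)
      also have "\<dots> \<le> g (m div M * M)" by (rule mult)
      also have "\<dots> \<le> g (m div M * M) + g (m mod M)" using nonneg by simp
      also have "\<dots> \<le> g m" using super[of "m div M * M" "m mod M"] by simp
      finally have "(real m / real M - 1) * g M / real m \<le> g m / real m"
        by (rule divide_right_mono) simp
      then show ?thesis using m M(1) by (simp add: field_simps)
    qed
    have "(\<lambda>m. g M / real M - g M / real m) \<longlonglongrightarrow> g M / real M - 0"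
      by (intro tendsto_intros lim_const_over_n)
    then have "\<forall>\<^sub>F m in sequentially. x < g M / real M - g M / real m"
      using M(2) by (intro order_tendstoD(1)) auto
    then show "\<forall>\<^sub>F m in sequentially. x < g m / real m"
      using eventually_gt_at_top[of "0::nat"]
      proof eventually_elim
      case (elim m)
      then show ?case using lower[of m] by linarith
    qed
  next
    fix x assume "L < x"
    show "\<forall>\<^sub>F m in sequentially. g m / real m < x"
      using eventually_gt_at_top[of "0::nat"]
      proof eventually_elim
      case (elim m)
      then show ?case using upper[of m] \<open>L < x\<close> by linarith
    qed
  qed
  then show ?thesis using upper by blast
qed

section \<open>Restrictions as values of the trilinear form\<close>

lemma restricts_to_unit_iff_trilin:
  "restricts_to_unit n T r \<longleftrightarrow>
     (\<exists>u v w. \<forall>p<r. \<forall>q<r. \<forall>s<r. trilin n T (u p) (v q) (w s) = (if p = q \<and> q = s then 1 else 0))"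
proof
  assume "restricts_to_unit n T r"
  then obtain A B C where car: "A \<in> carrier_mat r n" "B \<in> carrier_mat r n" "C \<in> carrier_mat r n"
    and eq: "\<forall>p<r. \<forall>q<r. \<forall>s<r. tensor_apply A B C T p q s = unit_tensor r p q s"
    unfolding restricts_to_unit_def by blast
  have "trilin n T (\<lambda>i. A $$ (p, i)) (\<lambda>j. B $$ (q, j)) (\<lambda>k. C $$ (s, k)) = (if p = q \<and> q = s then 1 else 0)"
    if "p < r" "q < r" "s < r" for p q s
    using eq that car by (simp add: trilin_eq tensor_apply_def unit_tensor_eq)
  then show "\<exists>u v w. \<forall>p<r. \<forall>q<r. \<forall>s<r. trilin n T (u p) (v q) (w s) = (if p = q \<and> q = s then 1 else 0)"
    by (intro exI[of _ "\<lambda>p i. A $$ (p, i)"] exI[of _ "\<lambda>p i. B $$ (p, i)"] exI[of _ "\<lambda>p i. C $$ (p, i)"]) simp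
next
  assume "\<exists>u v w. \<forall>p<r. \<forall>q<r. \<forall>s<r. trilin n T (u p) (v q) (w s) = (if p = q \<and> q = s then 1 else 0)"
  then obtain u v w where
    eq: "\<forall>p<r. \<forall>q<r. \<forall>s<r. trilin n T (u p) (v q) (w s) = (if p = q \<and> q = s then 1 else 0)"
    by blast
  have "tensor_apply (mat r n (\<lambda>(p, i). u p i)) (mat r n (\<lambda>(p, i). v p i)) (mat r n (\<lambda>(p, i). w p i)) T p q s
    = unit_tensor r p q s" if "p < r" "q < r" "s < r" for p q s
    using eq[rule_format, OF that] that by (simp add: trilin_eq tensor_apply_def unit_tensor_eq)
  then show "restricts_to_unit n T r"
    unfolding restricts_to_unit_def by (meson mat_carrier)
qed

text \<open>
  \<open>T\<close> restricts to the tensor \<open>\<phi>\<close> with legs indexed by arbitrary types.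
\<close>

definition evaluates :: "nat \<Rightarrow> 'a::field tensor3 \<Rightarrow> ('x \<Rightarrow> 'y \<Rightarrow> 'z \<Rightarrow> 'a) \<Rightarrow> bool" where
  "evaluates n T \<phi> \<longleftrightarrow> (\<exists>u v w. \<forall>x y z. trilin n T (u x) (v y) (w z) = \<phi> x y z)"

lemma evaluates_reindex:
  assumes "evaluates n T \<phi>" "\<And>x y z. \<psi> x y z = \<phi> (f x) (g y) (h z)"
  shows "evaluates n T \<psi>"
proof -
  from assms(1) obtain u v w where "\<forall>x y z. trilin n T (u x) (v y) (w z) = \<phi> x y z"
    unfolding evaluates_def by blast
  then show ?thesis unfolding evaluates_def
    by (intro exI[of _ "\<lambda>x. u (f x)"] exI[of _ "\<lambda>y. v (g y)"] exI[of _ "\<lambda>z. w (h z)"]) (simp add: assms(2))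
qed

lemma restricts_to_unitI:
  assumes "evaluates n T \<phi>"
    and "\<And>p q s. p < r \<Longrightarrow> q < r \<Longrightarrow> s < r \<Longrightarrow> \<phi> (f p) (g q) (h s) = (if p = q \<and> q = s then 1 else 0)"
  shows "restricts_to_unit n T r"
proof -
  from assms(1) obtain u v w where "\<forall>x y z. trilin n T (u x) (v y) (w z) = \<phi> x y z"
    unfolding evaluates_def by blast
  then show ?thesis unfolding restricts_to_unit_iff_trilin
    by (intro exI[of _ "\<lambda>x. u (f x)"] exI[of _ "\<lambda>y. v (g y)"] exI[of _ "\<lambda>z. w (h z)"]) (simp add: assms(2))
qed

lemma trilin_kronecker:
  "trilin (N * n) (kronecker n S T) (\<lambda>i. u (i div n) * u' (i mod n)) (\<lambda>i. v (i div n) * v' (i mod n))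
     (\<lambda>i. w (i div n) * w' (i mod n)) = trilin N S u v w * trilin n T u' v' w'"
proof -
  have 3: "(\<Sum>k<N * n. w (k div n) * w' (k mod n) * kronecker n S T i j k)
    = (\<Sum>c<N. w c * S (i div n) (j div n) c) * (\<Sum>d<n. w' d * T (i mod n) (j mod n) d)" for i j
    by (simp add: kronecker_def flip: sum_div_mod_product) (simp add: mult_ac)
  have 2: "(\<Sum>j<N * n. v (j div n) * v' (j mod n) *
      ((\<Sum>c<N. w c * S (i div n) (j div n) c) * (\<Sum>d<n. w' d * T (i mod n) (j mod n) d)))
    = (\<Sum>b<N. v b * (\<Sum>c<N. w c * S (i div n) b c)) * (\<Sum>b<n. v' b * (\<Sum>d<n. w' d * T (i mod n) b d))" for i
    by (subst sum_div_mod_product[symmetric]) (simp add: mult_ac)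
  show ?thesis
    unfolding trilin_def 3 2 by (subst sum_div_mod_product[symmetric]) (simp add: mult_ac)
qed

lemma evaluates_kronecker:
  assumes "evaluates N S \<phi>" "evaluates n T \<psi>"
  shows "evaluates (N * n) (kronecker n S T) (\<lambda>(x, x') (y, y') (z, z'). \<phi> x y z * \<psi> x' y' z')"
proof -
  from assms obtain u v w u' v' w' where
    "\<forall>x y z. trilin N S (u x) (v y) (w z) = \<phi> x y z" "\<forall>x y z. trilin n T (u' x) (v' y) (w' z) = \<psi> x y z"
    unfolding evaluates_def by blast
  then show ?thesis unfolding evaluates_def
    by (intro exI[of _ "\<lambda>(x, x') i. u x (i div n) * u' x' (i mod n)"]
        exI[of _ "\<lambda>(x, x') i. v x (i div n) * v' x' (i mod n)"]
        exI[of _ "\<lambda>(x, x') i. w x (i div n) * w' x' (i mod n)"]) (simp add: trilin_kronecker)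
qed

text \<open>Indices are digit strings in base \<open>n\<close>, and the last \<open>m'\<close>
  digits belong to the right factor.\<close>

lemma kronecker_power_add:
  assumes "n > 0"
  shows "kronecker_power n T (m + m') = kronecker (n ^ m') (kronecker_power n T m) (kronecker_power n T m')"
proof (induction m')
  case 0
  show ?case by (simp add: kronecker_def)
next
  case (Suc m')
  have div: "i div n div n ^ m' = i div (n * n ^ m')" for i by (simp add: div_mult2_eq)
  have mod: "(i mod (n * n ^ m')) div n = (i div n) mod n ^ m'" "(i mod (n * n ^ m')) mod n = i mod n" for i
    using assms by (simp_all add: mod_mult2_eq)
  show ?case using Suc by (simp add: kronecker_def div mod mult.assoc)
qed

lemma evaluates_power_add:
  assumes "n > 0" "evaluates (n ^ m) (kronecker_power n T m) \<phi>" "evaluates (n ^ m') (kronecker_power n T m') \<psi>"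
  shows "evaluates (n ^ (m + m')) (kronecker_power n T (m + m'))
    (\<lambda>(x, x') (y, y') (z, z'). \<phi> x y z * \<psi> x' y' z')"
  using evaluates_kronecker[OF assms(2,3)] by (simp add: kronecker_power_add[OF assms(1)] power_add)

lemma evaluates_power_mult:
  assumes n: "n > 0" and \<phi>: "evaluates (n ^ m) (kronecker_power n T m) \<phi>"
  shows "evaluates (n ^ (k * m)) (kronecker_power n T (k * m)) (\<lambda>x y z. \<Prod>l<k. \<phi> (x l) (y l) (z l))"
proof (induction k)
  case 0
  show ?case unfolding evaluates_def
    by (intro exI[of _ "\<lambda>_ _. 1"]) (simp add: trilin_def)
next
  case (Suc k)
  \<comment> \<open>The added factor reads coordinate \<open>k\<close> of the index function, while
    the product over \<open>l < k\<close> does not see it.\<close>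
  from evaluates_power_add[OF n \<phi> Suc] show ?case
    unfolding mult_Suc
    by (rule evaluates_reindex[where f = "\<lambda>x. (x k, x)" and g = "\<lambda>x. (x k, x)" and h = "\<lambda>x. (x k, x)"])
      (simp add: mult.commute)
qed

lemma trilin_zero: "trilin n T (\<lambda>_. 0) v w = 0" "trilin n T u (\<lambda>_. 0) w = 0" "trilin n T u v (\<lambda>_. 0) = 0"
  by (simp_all add: trilin_eq)

text \<open>Extension by zero vectors gives an identity for all indices, as \<open>evaluates\<close>
  quantifies over whole types.\<close>

lemma contracts_families:
  assumes "contracts n T r"
  obtains u v w where "\<And>p q. trilin n T u (v p) (w q) = (if p = q \<and> p < r then 1 else 0)"
proof -
  from assms obtain u v w
    where *: "\<And>p q. p < r \<Longrightarrow> q < r \<Longrightarrow> trilin n T u (v p) (w q) = (if p = q then 1 else 0)"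
    unfolding contracts_def by blast
  have "trilin n T u (if p < r then v p else (\<lambda>_. 0)) (if q < r then w q else (\<lambda>_. 0))
    = (if p = q \<and> p < r then 1 else 0)" for p q
    by (auto simp: * trilin_zero)
  then show thesis by (rule that)
qed

text \<open>Each contraction is an identity matrix shared by two legs, with a leg of type
  \<open>unit\<close> where the vector is plugged in. Legs 2 and 3 share \<open>i\<close>, legs 1
  and 3 share \<open>j\<close>, legs 1 and 2 share \<open>k\<close>: this is the matrix
  multiplication tensor.\<close>

lemma evaluates_matrix_multiplication:
  fixes T :: "'a::field tensor3"
  assumes n: "n > 0"
    and 1: "contracts (n ^ m) (kronecker_power n T m) a"
    and 2: "contracts (n ^ m) (rotate_tensor (kronecker_power n T m)) b"
    and 3: "contracts (n ^ m) (rotate_tensor (rotate_tensor (kronecker_power n T m))) c"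
  shows "evaluates (n ^ (3 * m)) (kronecker_power n T (3 * m))
    (\<lambda>(j, k) (i, k') (i', j'). if i = i' \<and> j = j' \<and> k = k' \<and> i < a \<and> j < b \<and> k < c then 1 else 0)"
proof -
  have E1: "evaluates (n ^ m) (kronecker_power n T m)
      (\<lambda>(_::unit) p q. if p = q \<and> p < a then 1 else 0)"
  proof (rule contracts_families[OF 1])
    fix u v w
    assume "\<And>p q. trilin (n ^ m) (kronecker_power n T m) u (v p) (w q) = (if p = q \<and> p < a then 1 else 0)"
    then show ?thesis unfolding evaluates_def
      by (intro exI[of _ "\<lambda>_. u"] exI[of _ v] exI[of _ w]) auto
  qed
  have E2: "evaluates (n ^ m) (kronecker_power n T m)
      (\<lambda>p (_::unit) q. if p = q \<and> p < b then 1 else 0)"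
  proof (rule contracts_families[OF 2])
    fix u v w
    assume "\<And>p q. trilin (n ^ m) (rotate_tensor (kronecker_power n T m)) u (v p) (w q)
      = (if p = q \<and> p < b then 1 else 0)"
    then show ?thesis unfolding evaluates_def trilin_rotate
      by (intro exI[of _ w] exI[of _ "\<lambda>_. u"] exI[of _ v]) auto
  qed
  have E3: "evaluates (n ^ m) (kronecker_power n T m)
      (\<lambda>p q (_::unit). if p = q \<and> p < c then 1 else 0)"
  proof (rule contracts_families[OF 3])
    fix u v w
    assume "\<And>p q. trilin (n ^ m) (rotate_tensor (rotate_tensor (kronecker_power n T m))) u (v p) (w q)
      = (if p = q \<and> p < c then 1 else 0)"
    then show ?thesis unfolding evaluates_def trilin_rotate
      by (intro exI[of _ v] exI[of _ w] exI[of _ "\<lambda>_. u"]) auto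
  qed
  have "m + (m + m) = 3 * m" by simp
  note E = evaluates_power_add[OF n E1 evaluates_power_add[OF n E2 E3], unfolded this]
  show ?thesis
    by (rule evaluates_reindex[OF E, where f = "\<lambda>(j, k). ((), j, k)" and g = "\<lambda>(i, k). (i, (), k)"
          and h = "\<lambda>(i, j). (i, j, ())"]) auto
qed

text \<open>An index of each leg of the \<open>K\<close>-th power is an edge between two of the
  three parts, and the entry is 1 exactly when the three edges close up within range. Leg 1 takes
  the \<open>yz\<close> edges, leg 2 the \<open>xz\<close> edges and leg 3 the \<open>xy\<close>
  edges of the triangles.\<close>

lemma restricts_to_unit_power:
  fixes T :: "'a::field tensor3"
  assumes n: "n > 0" and T: "evaluates (n ^ M) (kronecker_power n T M)
    (\<lambda>(j, k) (i, k') (i', j'). if i = i' \<and> j = j' \<and> k = k' \<and> i < a \<and> j < b \<and> k < c then 1 else 0)"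
    and tri: "disjoint_triangles K a b c R"
  shows "restricts_to_unit (n ^ (K * M)) (kronecker_power n T (K * M)) R"
proof -
  from tri obtain x y z :: "nat \<Rightarrow> nat \<Rightarrow> nat"
    where 1: "\<forall>p<R. \<forall>l<K. x p l < a \<and> y p l < b \<and> z p l < c"
      and 2: "\<forall>p<R. \<forall>q<R. \<forall>s<R. (\<forall>l<K. x q l = x s l \<and> y p l = y s l \<and> z p l = z q l) \<longrightarrow> p = q \<and> q = s"
    unfolding disjoint_triangles_def by (elim exE conjE)
  let ?\<phi> = "\<lambda>(j, k) (i, k') (i', j'). if i = i' \<and> j = j' \<and> k = k' \<and> i < a \<and> j < b \<and> k < c then 1 else (0::'a)"
  show ?thesis
  proof (rule restricts_to_unitI[OF evaluates_power_mult[OF n T],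
        where f = "\<lambda>p l. (y p l, z p l)" and g = "\<lambda>q l. (x q l, z q l)" and h = "\<lambda>s l. (x s l, y s l)"])
    fix p q s assume pqs: "p < R" "q < R" "s < R"
    show "(\<Prod>l<K. ?\<phi> (y p l, z p l) (x q l, z q l) (x s l, y s l)) = (if p = q \<and> q = s then 1 else 0)"
    proof (cases "p = q \<and> q = s")
      case True
      then show ?thesis using 1 pqs by (auto intro!: prod.neutral)
    next
      case False
      then obtain l where "l < K" "\<not> (x q l = x s l \<and> y p l = y s l \<and> z p l = z q l)"
        using 2 pqs by blast
      then have "\<exists>l\<in>{..<K}. ?\<phi> (y p l, z p l) (x q l, z q l) (x s l, y s l) = 0"
        by (intro bexI[of _ l]) auto
      then show ?thesis using False by (auto intro!: prod_zero)
    qed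
  qed
qed

lemma restricts_to_unit_add:
  assumes n: "n > 0" and "restricts_to_unit (n ^ m) (kronecker_power n T m) r"
    "restricts_to_unit (n ^ m') (kronecker_power n T m') r'"
  shows "restricts_to_unit (n ^ (m + m')) (kronecker_power n T (m + m')) (r * r')"
proof -
  from assms(2) obtain u v w where 1: "\<forall>p<r. \<forall>q<r. \<forall>s<r.
      trilin (n ^ m) (kronecker_power n T m) (u p) (v q) (w s) = (if p = q \<and> q = s then 1 else 0)"
    unfolding restricts_to_unit_iff_trilin by blast
  from assms(3) obtain u' v' w' where 2: "\<forall>p<r'. \<forall>q<r'. \<forall>s<r'.
      trilin (n ^ m') (kronecker_power n T m') (u' p) (v' q) (w' s) = (if p = q \<and> q = s then 1 else 0)"
    unfolding restricts_to_unit_iff_trilin by blast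
  \<comment> \<open>The values are known only for indices below \<open>r\<close> and
    \<open>r'\<close>; naming the actual values gives functions defined everywhere.\<close>
  define \<phi> where "\<phi> p q s = trilin (n ^ m) (kronecker_power n T m) (u p) (v q) (w s)" for p q s
  define \<psi> where "\<psi> p q s = trilin (n ^ m') (kronecker_power n T m') (u' p) (v' q) (w' s)" for p q s
  have ev: "evaluates (n ^ m) (kronecker_power n T m) \<phi>" "evaluates (n ^ m') (kronecker_power n T m') \<psi>"
    unfolding evaluates_def \<phi>_def \<psi>_def by blast+
  let ?f = "\<lambda>p. (p div r', p mod r')"
  show ?thesis
  proof (rule restricts_to_unitI[OF evaluates_power_add[OF n ev], where f = ?f and g = ?f and h = ?f])
    fix p q s assume pqs: "p < r * r'" "q < r * r'" "s < r * r'"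
    then have "r' > 0" by (cases r') auto
    then have lt: "i div r' < r" "i mod r' < r'" if "i < r * r'" for i
      using that by (auto simp: less_mult_imp_div_less)
    have eq: "i = j \<longleftrightarrow> i div r' = j div r' \<and> i mod r' = j mod r'" for i j
      by (metis div_mult_mod_eq)
    show "(case ?f p of (x, x') \<Rightarrow> \<lambda>(y, y') (z, z'). \<phi> x y z * \<psi> x' y' z') (?f q) (?f s)
      = (if p = q \<and> q = s then 1 else 0)"
      using 1 2 lt pqs by (simp add: \<phi>_def \<psi>_def eq[of p q] eq[of q s])
  qed
qed

section \<open>Subrank estimates and the limit\<close>

lemma subrank_restricts: "restricts_to_unit n T (subrank n T)"
  unfolding subrank_def using Max_in[OF finite_restricts_to_unit] restricts_to_unit_0 by blast

lemma le_subrank: "restricts_to_unit n T r \<Longrightarrow> r \<le> subrank n T"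
  unfolding subrank_def by (intro Max_ge finite_restricts_to_unit) simp

text \<open>Positivity makes logarithms of subranks meaningful; a nonzero value of the trilinear
  form can be rescaled to 1.\<close>

lemma subrank_pos:
  assumes "nondegenerate n T" "n > 0"
  shows "subrank n T > 0"
proof -
  have "\<exists>u v w. trilin n T u v w \<noteq> 0"
  proof (rule ccontr)
    assume *: "\<nexists>u v w. trilin n T u v w \<noteq> 0"
    have "(\<Sum>k<n. T i j k * 1) = 0" if "i < n" "j < n" for i j
      using trilin_unit_vectors[OF that, of T "\<lambda>_. 1"] * by simp
    from nondegenerateD[where w = "\<lambda>_. 1", OF assms(1) this assms(2)] show False by simp
  qed
  then obtain u v w where nz: "trilin n T u v w \<noteq> 0" by blast
  have "trilin n T (\<lambda>i. inverse (trilin n T u v w) * u i) v w = 1"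
    using nz by (simp add: trilin_scale1)
  then have "restricts_to_unit n T 1"
    unfolding restricts_to_unit_iff_trilin
    by (intro exI[of _ "\<lambda>_ i. inverse (trilin n T u v w) * u i"] exI[of _ "\<lambda>_. v"] exI[of _ "\<lambda>_. w"]) simp
  from le_subrank[OF this] show ?thesis by simp
qed

text \<open>Here 8 is 4 from the triangles times 2 from the rank products. The number
  \<open>D\<close> depends on \<open>m\<close> but not on \<open>k\<close>, so the last factor is
  polynomial in \<open>k\<close>.\<close>

lemma subrank_power_lower_bound:
  fixes T :: "'a::field tensor3"
  assumes T: "concise n T" and n: "n > 0"
  shows "\<exists>D. \<forall>k. (n ^ m) ^ k \<le> 8 ^ k * subrank (n ^ (k * (3 * m))) (kronecker_power n T (k * (3 * m))) *
    (Suc (3 * k * D))\<^sup>2"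
proof -
  define S where "S = kronecker_power n T m"
  define a where "a = max_contraction (n ^ m) S"
  define b where "b = max_contraction (n ^ m) (rotate_tensor S)"
  define c where "c = max_contraction (n ^ m) (rotate_tensor (rotate_tensor S))"
  have nd: "nondegenerate (n ^ m) S" "nondegenerate (n ^ m) (rotate_tensor S)"
    "nondegenerate (n ^ m) (rotate_tensor (rotate_tensor S))"
    using concise_imp_nondegenerate[OF T] by (simp_all add: S_def rotate_kronecker_power nondegenerate_power)
  have prods: "n ^ m \<le> 2 * (a * b)" "n ^ m \<le> 2 * (b * c)" "n ^ m \<le> 2 * (c * a)"
    using nd[THEN max_contraction_product] by (simp_all add: a_def b_def c_def rotate_thrice mult.assoc)
  have "n ^ m > 0" using n by simp
  then have pos: "a > 0" "b > 0" "c > 0" using prods by (cases a; cases b; cases c; simp)+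
  have ev: "evaluates (n ^ (3 * m)) (kronecker_power n T (3 * m))
    (\<lambda>(j, k) (i, k') (i', j'). if i = i' \<and> j = j' \<and> k = k' \<and> i < a \<and> j < b \<and> k < c then 1 else 0)"
    by (rule evaluates_matrix_multiplication[OF n])
      (auto simp: a_def b_def c_def S_def intro: max_contraction(1))
  \<comment> \<open>Half of \<open>n ^ m\<close> rounded up is still below each integer product, and
    doubling it recovers \<open>n ^ m\<close>.\<close>
  define N where "N = Suc (n ^ m) div 2"
  have N: "N \<le> a * b" "N \<le> b * c" "N \<le> c * a" "n ^ m \<le> 2 * N"
    using prods unfolding N_def by linarith+
  have "(n ^ m) ^ k \<le> 8 ^ k * subrank (n ^ (k * (3 * m))) (kronecker_power n T (k * (3 * m))) *
    (Suc (3 * k * (a + b + c)\<^sup>2))\<^sup>2" for k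
  proof -
    from many_disjoint_triangles[OF pos N(1-3), of k] obtain R where R: "disjoint_triangles k a b c R"
      and le: "N ^ k \<le> 4 ^ k * R * (Suc (3 * k * (a + b + c)\<^sup>2))\<^sup>2" by blast
    have "R \<le> subrank (n ^ (k * (3 * m))) (kronecker_power n T (k * (3 * m)))"
      by (rule le_subrank[OF restricts_to_unit_power[OF n ev R]])
    then have "2 ^ k * (4 ^ k * R * (Suc (3 * k * (a + b + c)\<^sup>2))\<^sup>2)
      \<le> 2 ^ k * (4 ^ k * subrank (n ^ (k * (3 * m))) (kronecker_power n T (k * (3 * m))) *
        (Suc (3 * k * (a + b + c)\<^sup>2))\<^sup>2)"
      by (intro mult_le_mono) simp_all
    moreover have "(n ^ m) ^ k \<le> 2 ^ k * N ^ k"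
      using power_mono[OF N(4), of k] by (simp add: power_mult_distrib)
    moreover have "2 ^ k * N ^ k \<le> 2 ^ k * (4 ^ k * R * (Suc (3 * k * (a + b + c)\<^sup>2))\<^sup>2)"
      using le by (rule mult_le_mono2)
    moreover have "(2::nat) ^ k * 4 ^ k = 8 ^ k" by (simp flip: power_mult_distrib)
    ultimately show ?thesis by (simp only: mult.assoc[symmetric])
  qed
  then show ?thesis by blast
qed

theorem theorem5p14:
  fixes n :: nat and T :: "'a::field tensor3"
  assumes "concise n T"
  shows "\<exists>L::real.
    (\<lambda>m. real (subrank (n ^ m) (kronecker_power n T m)) powr (1 / real m)) \<longlonglongrightarrow> L \<and>
    L \<ge> real n powr (1 / 3)"
proof (cases "n = 0")
  case True
  \<comment> \<open>The term \<open>m = 0\<close> is excluded because \<open>0 ^ 0 = 1\<close>; all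
    others vanish, as does the claimed bound.\<close>
  have "subrank (n ^ m) (kronecker_power n T m) = 0" if "m > 0" for m
    using restricts_to_unit_le[OF subrank_restricts[of "n ^ m" "kronecker_power n T m"]] True that by (simp add: power_0_left)
  then have "\<forall>\<^sub>F m in sequentially. real (subrank (n ^ m) (kronecker_power n T m)) powr (1 / real m) = 0"
    by (intro eventually_mono[OF eventually_gt_at_top[of "0::nat"]]) simp
  then show ?thesis using True by (intro exI[of _ 0]) (simp add: tendsto_eventually)
next
  case False
  then have n: "n > 0" by simp
  define Q where "Q m = subrank (n ^ m) (kronecker_power n T m)" for m
  define g where "g m = ln (real (Q m))" for m
  have Q_pos: "Q m > 0" for m
    unfolding Q_def using n concise_imp_nondegenerate(1)[OF assms]
    by (intro subrank_pos nondegenerate_power) simp_all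
  have "Q m \<le> n ^ m" for m
    unfolding Q_def by (rule restricts_to_unit_le[OF subrank_restricts])
  then have "g m \<le> ln (real n ^ m)" for m
    unfolding g_def using Q_pos[of m] by (metis ln_mono of_nat_0_less_iff of_nat_le_iff of_nat_power)
  then have bound: "g m \<le> ln (real n) * real m" for m
    using n by (simp add: ln_realpow mult.commute)
  have nonneg: "0 \<le> g m" for m unfolding g_def using Q_pos[of m] by simp
  have super: "g m + g k \<le> g (m + k)" for m k
  proof -
    have "Q m * Q k \<le> Q (m + k)"
      unfolding Q_def by (intro le_subrank restricts_to_unit_add[OF n] subrank_restricts)
    then have "ln (real (Q m) * real (Q k)) \<le> ln (real (Q (m + k)))"
      using Q_pos by (subst ln_le_cancel_iff) (auto simp flip: of_nat_mult)
    then show ?thesis unfolding g_def using Q_pos[of m] Q_pos[of k] by (simp add: ln_mult)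
  qed
  from superadditive_limit[OF nonneg bound super] obtain L
    where lim: "(\<lambda>m. g m / real m) \<longlonglongrightarrow> L" and upper: "\<And>m. m > 0 \<Longrightarrow> g m / real m \<le> L" by blast
  \<comment> \<open>For fixed \<open>m\<close>, letting \<open>k\<close> grow removes the polynomial
    factor; what remains of the losses is \<open>ln 8 / real m\<close>, which disappears when
    \<open>m\<close> grows afterwards.\<close>
  have step: "ln (real n) - ln 8 / real m \<le> 3 * L" if m: "m > 0" for m
  proof -
    from subrank_power_lower_bound[OF assms n, of m] obtain D
      where D: "\<And>k. (n ^ m) ^ k \<le> 8 ^ k * Q (k * (3 * m)) * (Suc (3 * k * D))\<^sup>2"
      unfolding Q_def by blast
    have le: "real m * ln (real n) - ln 8 - 2 * (ln (real (Suc (3 * k * D))) / real k) \<le> 3 * real m * L"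
      if k: "k > 0" for k
    proof -
      have "real ((n ^ m) ^ k) \<le> real (8 ^ k * Q (k * (3 * m)) * (Suc (3 * k * D))\<^sup>2)"
        using D[of k] of_nat_le_iff by blast
      then have "ln ((real n ^ m) ^ k) \<le> ln (8 ^ k * real (Q (k * (3 * m))) * (real (Suc (3 * k * D)))\<^sup>2)"
        using n by (intro ln_mono) simp_all
      also have "\<dots> = real k * ln 8 + g (k * (3 * m)) + 2 * ln (real (Suc (3 * k * D)))"
      proof -
        have ln: "ln (8 ^ k * q * y\<^sup>2) = real k * ln 8 + ln q + 2 * ln y" if "q > 0" "y > 0" for q y :: real
          using that by (simp add: ln_mult ln_realpow)
        show ?thesis unfolding g_def by (rule ln) (use Q_pos in \<open>simp_all only: of_nat_0_less_iff zero_less_Suc\<close>)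
      qed
      also have "ln ((real n ^ m) ^ k) = real k * (real m * ln (real n))"
        using n by (simp add: ln_realpow)
      also have "g (k * (3 * m)) \<le> real k * (3 * real m * L)"
        using upper[of "k * (3 * m)"] k m by (simp add: field_simps)
      finally have "real k * (real m * ln (real n)) \<le> real k * ln 8 + real k * (3 * real m * L) + 2 * ln (real (Suc (3 * k * D)))"
        by simp
      then show ?thesis using k by (simp add: field_simps)
    qed
    have "(\<lambda>k. ln (real (Suc (3 * k * D))) / real k) \<longlonglongrightarrow> 0"
    proof (cases "D = 0")
      case False
      then have "real D > 0" by simp
      then have "(\<lambda>k. ln (1 + 3 * real k * real D) / real k) \<longlonglongrightarrow> 0" by real_asymp
      then show ?thesis by simp
    qed simp
    then have "(\<lambda>k. real m * ln (real n) - ln 8 - 2 * (ln (real (Suc (3 * k * D))) / real k))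
      \<longlonglongrightarrow> real m * ln (real n) - ln 8 - 2 * 0"
      by (intro tendsto_intros)
    then have "real m * ln (real n) - ln 8 - 2 * 0 \<le> 3 * real m * L"
      by (rule LIMSEQ_le_const2) (intro exI[of _ 1] allI impI le, simp)
    then show ?thesis using m by (simp add: field_simps)
  qed
  have "(\<lambda>m. ln (real n) - ln 8 / real m) \<longlonglongrightarrow> ln (real n) - 0"
    by (intro tendsto_intros lim_const_over_n)
  then have "ln (real n) - 0 \<le> 3 * L"
    by (rule LIMSEQ_le_const2) (intro exI[of _ 1] allI impI step, simp)
  then have "real n powr (1 / 3) \<le> exp L" using n by (simp add: powr_def)
  moreover have "(\<lambda>m. real (Q m) powr (1 / real m)) \<longlonglongrightarrow> exp L"
  proof -
    have "real (Q m) powr (1 / real m) = exp (g m / real m)" for m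
      using Q_pos[of m] by (simp add: powr_def g_def)
    then show ?thesis using tendsto_exp[OF lim] by simp
  qed
  ultimately show ?thesis unfolding Q_def by blast
qed

end
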